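(* Let $0<\rho<R$, $A(\rho,R)=\{x\in\mathbb R^2:\rho^2<x_1^2+x_2^2<R^2\}$, $B>0$ a constant, and ${\bf A}=\frac B2(-x_2,x_1)$. Then for every $h>0$, \[ \lambda^D_{P_-}(h,{\bf A},B,A(\rho,R))\ \ge\ h^2\,\frac{{\bf j}^2}{\pi(R^2-\rho^2)}\exp\Big(-\frac{(R^2-\rho^2)B}{2h}\Big), \] where ${\bf j}$ is the smallest positive zero of the Bessel function $J_0$.
   Context: $\lambda^D_{P_-}(h,{\bf A},B,\Omega)=\inf_{u\in H^1_0(\Omega)\setminus\{0\}}\big(\|(hD-{\bf A})u\|^2-h\int_\Omega B|u|^2\big)/\|u\|^2$, $D=-i\nabla$, the ground state energy of the Dirichlet Pauli operator $(hD_{x_1}-A_1)^2+(hD_{x_2}-A_2)^2-hB$ on $\Omega$. *)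

theory Defs
  imports "HOL-Analysis.Analysis"
begin

type_synonym pt = "real \<times> real"

fun Ck :: "nat \<Rightarrow> (pt \<Rightarrow> complex) \<Rightarrow> bool" where
  "Ck 0 f = continuous_on UNIV f"
| "Ck (Suc n) f = (\<exists>D1 D2. (\<forall>x. (f has_derivative
        (\<lambda>v. of_real (fst v) * D1 x + of_real (snd v) * D2 x)) (at x))
        \<and> Ck n D1 \<and> Ck n D2)"

definition smooth2 :: "(pt \<Rightarrow> complex) \<Rightarrow> bool" where
  "smooth2 f \<longleftrightarrow> (\<forall>n. Ck n f)"

definition pd1 :: "(pt \<Rightarrow> complex) \<Rightarrow> pt \<Rightarrow> complex" where
  "pd1 f x = frechet_derivative f (at x) (1, 0)"

definition pd2 :: "(pt \<Rightarrow> complex) \<Rightarrow> pt \<Rightarrow> complex" where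
  "pd2 f x = frechet_derivative f (at x) (0, 1)"

definition test_fun :: "pt set \<Rightarrow> (pt \<Rightarrow> complex) \<Rightarrow> bool" where
  "test_fun \<Omega> \<phi> \<longleftrightarrow> smooth2 \<phi> \<and> compact (closure {x. \<phi> x \<noteq> 0})
      \<and> closure {x. \<phi> x \<noteq> 0} \<subseteq> \<Omega>"

definition L2fun :: "(pt \<Rightarrow> complex) \<Rightarrow> bool" where
  "L2fun u \<longleftrightarrow> u \<in> borel_measurable lborel \<and> integrable lborel (\<lambda>x. (cmod (u x))\<^sup>2)"

definition L2dist2 :: "(pt \<Rightarrow> complex) \<Rightarrow> (pt \<Rightarrow> complex) \<Rightarrow> real" where
  "L2dist2 u v = (LINT x|lborel. (cmod (u x - v x))\<^sup>2)"

text \<open>u (extended by zero outside Omega) belongs to H^1_0(Omega) with weak gradient (g1,g2):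
  u, g1, g2 are L^2 limits of test functions and of their gradients, i.e.
  H^1_0(Omega) is the closure of C_c^infinity(Omega) in the H^1 norm.\<close>
definition H10 :: "pt set \<Rightarrow> (pt \<Rightarrow> complex) \<Rightarrow> (pt \<Rightarrow> complex) \<Rightarrow> (pt \<Rightarrow> complex) \<Rightarrow> bool" where
  "H10 \<Omega> u g1 g2 \<longleftrightarrow> L2fun u \<and> L2fun g1 \<and> L2fun g2 \<and>
     (\<exists>\<phi>::nat \<Rightarrow> pt \<Rightarrow> complex. (\<forall>n. test_fun \<Omega> (\<phi> n))
        \<and> (\<lambda>n. L2dist2 (\<phi> n) u) \<longlonglongrightarrow> 0
        \<and> (\<lambda>n. L2dist2 (pd1 (\<phi> n)) g1) \<longlonglongrightarrow> 0
        \<and> (\<lambda>n. L2dist2 (pd2 (\<phi> n)) g2) \<longlonglongrightarrow> 0)"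

text \<open>Rayleigh quotient of the Dirichlet Pauli operator (hD - A)^2 - hB, D = -i nabla.\<close>
definition pauli_quot :: "real \<Rightarrow> (pt \<Rightarrow> pt) \<Rightarrow> (pt \<Rightarrow> real) \<Rightarrow> pt set
     \<Rightarrow> (pt \<Rightarrow> complex) \<Rightarrow> (pt \<Rightarrow> complex) \<Rightarrow> (pt \<Rightarrow> complex) \<Rightarrow> real" where
  "pauli_quot h A B \<Omega> u g1 g2 =
     ((LINT x:\<Omega>|lborel. (cmod (of_real h * (- \<i>) * g1 x - of_real (fst (A x)) * u x))\<^sup>2
                       + (cmod (of_real h * (- \<i>) * g2 x - of_real (snd (A x)) * u x))\<^sup>2)
      - h * (LINT x:\<Omega>|lborel. B x * (cmod (u x))\<^sup>2))
     / (LINT x:\<Omega>|lborel. (cmod (u x))\<^sup>2)"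

definition lambda_D_Pminus :: "real \<Rightarrow> (pt \<Rightarrow> pt) \<Rightarrow> (pt \<Rightarrow> real) \<Rightarrow> pt set \<Rightarrow> real" where
  "lambda_D_Pminus h A B \<Omega> = Inf {pauli_quot h A B \<Omega> u g1 g2 | u g1 g2.
      H10 \<Omega> u g1 g2 \<and> (LINT x:\<Omega>|lborel. (cmod (u x))\<^sup>2) \<noteq> 0}"

definition annulus :: "real \<Rightarrow> real \<Rightarrow> pt set" where
  "annulus \<rho> R = {x. \<rho>\<^sup>2 < (fst x)\<^sup>2 + (snd x)\<^sup>2 \<and> (fst x)\<^sup>2 + (snd x)\<^sup>2 < R\<^sup>2}"

definition BesselJ0 :: "real \<Rightarrow> real" where
  "BesselJ0 x = (\<Sum>k. (-1) ^ k * (x / 2) ^ (2 * k) / (fact k)\<^sup>2)"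

definition j0_first_zero :: real where
  "j0_first_zero = Inf {x. 0 < x \<and> BesselJ0 x = 0}"

end

theory Submission
  imports Defs
begin

text \<open>
  Write \<open>\<psi> = B |x|\<^sup>2 / 4\<close>, so that \<open>A = (- \<partial>\<^sub>2\<psi>, \<partial>\<^sub>1\<psi>)\<close>, and \<open>v = exp (\<psi> / h) u\<close>. Up to divergences, which
  integrate to zero for test functions, the Pauli form is \<open>h\<^sup>2 exp (- 2 \<psi> / h) |\<partial>\<^sub>1 v + i \<partial>\<^sub>2 v|\<^sup>2\<close>, and
  \<open>|\<partial>\<^sub>1 v + i \<partial>\<^sub>2 v|\<^sup>2\<close> is \<open>|\<nabla> v|\<^sup>2\<close>. The exponential costs twice the oscillation of \<open>\<psi> / h\<close> on the
  annulus, which is the exponent in the bound. What remains is a lower bound for the Dirichlet Laplacian: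
  the positive function \<open>w = R\<^sup>2 - |x|\<^sup>2\<close> satisfies \<open>- \<Delta> w = 4 \<ge> 4 w / (R\<^sup>2 - \<rho>\<^sup>2)\<close> on the annulus, so by
  Barta's argument the first eigenvalue is at least \<open>4 / (R\<^sup>2 - \<rho>\<^sup>2)\<close>. No rearrangement is needed,
  because \<open>j\<^sup>2 \<le> 8 < 4 \<pi>\<close>.
\<close>

section \<open>Gradients in the plane\<close>

text \<open>The total derivative in coordinates. Values lie in any normed space, so one calculus
  serves complex functions and real ones such as \<open>|u|\<^sup>2\<close>.\<close>

definition has_grad :: "(pt \<Rightarrow> 'a::real_normed_vector) \<Rightarrow> 'a \<Rightarrow> 'a \<Rightarrow> pt \<Rightarrow> bool" where
  "has_grad f a b x \<longleftrightarrow> (f has_derivative (\<lambda>v. fst v *\<^sub>R a + snd v *\<^sub>R b)) (at x)"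

lemma has_grad_unique: "has_grad f a b x \<Longrightarrow> has_grad f a' b' x \<Longrightarrow> a = a' \<and> b = b'"
  unfolding has_grad_def
  by (drule (1) has_derivative_unique, auto dest: fun_cong[of _ _ "(1,0)"] fun_cong[of _ _ "(0,1)"])

lemma has_grad_eq_rhs: "has_grad f a b x \<Longrightarrow> a = a' \<Longrightarrow> b = b' \<Longrightarrow> has_grad f a' b' x"
  by simp

lemma has_grad_continuous: "(\<And>x. has_grad f (f1 x) (f2 x) x) \<Longrightarrow> continuous_on S f"
  unfolding has_grad_def
  by (meson continuous_at_imp_continuous_on has_derivative_continuous)

lemma has_grad_const: "has_grad (\<lambda>x. c) 0 0 x"
  unfolding has_grad_def by simp

lemma has_grad_fst: "has_grad fst (1::real) 0 x"
  and has_grad_snd: "has_grad snd (0::real) 1 x"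
  unfolding has_grad_def by (auto intro!: derivative_eq_intros)

lemma has_grad_add: "has_grad f a b x \<Longrightarrow> has_grad g c d x \<Longrightarrow> has_grad (\<lambda>x. f x + g x) (a + c) (b + d) x"
  unfolding has_grad_def
  by (drule (1) has_derivative_add) (auto elim!: has_derivative_eq_rhs simp: algebra_simps)

lemma has_grad_mult:
  fixes f g :: "pt \<Rightarrow> 'a::real_normed_algebra"
  assumes "has_grad f a b x" "has_grad g c d x"
  shows "has_grad (\<lambda>x. f x * g x) (a * g x + f x * c) (b * g x + f x * d) x"
  using assms unfolding has_grad_def
  by (intro has_derivative_eq_rhs[OF has_derivative_mult]) (auto simp: algebra_simps)

lemma has_grad_bounded_linear:
  assumes "bounded_linear L" "has_grad f a b x"
  shows "has_grad (\<lambda>x. L (f x)) (L a) (L b) x"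
proof -
  interpret L: bounded_linear L by fact
  show ?thesis using L.has_derivative[of f] assms(2) unfolding has_grad_def
    by (fastforce simp: L.add L.scaleR elim!: has_derivative_eq_rhs)
qed

lemma has_grad_chain:
  fixes g :: "pt \<Rightarrow> 'a::real_normed_field"
  assumes "(F has_field_derivative d) (at (g x))" "has_grad g a b x"
  shows "has_grad (\<lambda>x. F (g x)) (d * a) (d * b) x"
  using has_derivative_compose[OF assms(2)[unfolded has_grad_def] assms(1)[unfolded has_field_derivative_def]]
  unfolding has_grad_def by (auto simp: algebra_simps elim!: has_derivative_eq_rhs)

lemma has_grad_slices:
  assumes "has_grad f a b (s, t)"
  shows "((\<lambda>s. f (s, t)) has_vector_derivative a) (at s within S)"
    and "((\<lambda>t. f (s, t)) has_vector_derivative b) (at t within S)"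
proof -
  have f: "(f has_derivative (\<lambda>v. fst v *\<^sub>R a + snd v *\<^sub>R b)) (at (s, t))"
    using assms by (simp add: has_grad_def)
  have "((\<lambda>s. (s, t)) has_derivative (\<lambda>h. (h, 0))) (at s within S)"
    by (auto intro!: derivative_eq_intros)
  from has_derivative_compose[OF this f]
  show "((\<lambda>s. f (s, t)) has_vector_derivative a) (at s within S)"
    by (simp add: has_vector_derivative_def)
  have "((\<lambda>t. (s, t)) has_derivative (\<lambda>h. (0, h))) (at t within S)"
    by (auto intro!: derivative_eq_intros)
  from has_derivative_compose[OF this f]
  show "((\<lambda>t. f (s, t)) has_vector_derivative b) (at t within S)"
    by (simp add: has_vector_derivative_def)
qed

lemma has_grad_zero_off:
  assumes "closed K" "\<And>x. x \<notin> K \<Longrightarrow> f x = 0" "x \<notin> K"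
  shows "has_grad f 0 0 x"
  unfolding has_grad_def
  by (rule has_derivative_transform_within_open[where f="\<lambda>_. 0" and s="- K"]) (use assms in auto)

lemma grad_zero_off:
  assumes "closed K" "\<And>x. x \<notin> K \<Longrightarrow> f x = 0" "x \<notin> K" "has_grad f a b x"
  shows "a = 0" "b = 0"
  using has_grad_unique[OF assms(4) has_grad_zero_off[OF assms(1-3)]] by auto

text \<open>Write \<open>f (y, t) - f (p - 1, t)\<close> as the integral of \<open>f1\<close> over
  the first variable. Differentiating under the integral sign in \<open>t\<close> turns this into
  \<open>f2 (y, q) - f2 (p - 1, q)\<close> as the integral of \<open>f12\<close>, and
  differentiating in \<open>y\<close> compares \<open>f21\<close> with \<open>f12\<close>.\<close>

lemma mixed_partials_commute:
  fixes f :: "pt \<Rightarrow> 'a::banach"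
  assumes f: "\<And>x. has_grad f (f1 x) (f2 x) x"
    and f1: "\<And>x. has_grad f1 (f11 x) (f12 x) x"
    and f2: "\<And>x. has_grad f2 (f21 x) (f22 x) x"
    and cont: "continuous_on UNIV f12"
  shows "f12 x = f21 x"
proof -
  obtain p q where x: "x = (p, q)" by force
  have c1: "continuous_on S (\<lambda>s. f1 (s, t))" for S t
    by (intro continuous_on_compose2[OF has_grad_continuous[of f1, OF f1, of UNIV]] continuous_intros) auto
  have c12: "continuous_on S (\<lambda>s. f12 (s, t))" for S t
    by (intro continuous_on_compose2[OF cont] continuous_intros) auto
  have ftc: "f (y, t) - f (p - 1, t) = integral (cbox (p - 1) y) (\<lambda>s. f1 (s, t))" if "p - 1 \<le> y" for y t
    using fundamental_theorem_of_calculus[OF that, of "\<lambda>s. f (s, t)" "\<lambda>s. f1 (s, t)"]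
      has_grad_slices(1)[OF f] by (simp add: integral_unique)
  have f2_eq: "f2 (y, q) - f2 (p - 1, q) = integral (cbox (p - 1) y) (\<lambda>s. f12 (s, q))" if "p - 1 \<le> y" for y
  proof -
    have "((\<lambda>t. integral (cbox (p - 1) y) (\<lambda>s. f1 (s, t))) has_vector_derivative
        integral (cbox (p - 1) y) (\<lambda>s. f12 (s, q))) (at q within UNIV)"
    proof (rule leibniz_rule_vector_derivative)
      show "((\<lambda>t. f1 (s, t)) has_vector_derivative f12 (s, t)) (at t within UNIV)" for s t
        using has_grad_slices(2)[OF f1] .
      show "(\<lambda>s. f1 (s, t)) integrable_on cbox (p - 1) y" for t
        by (intro integrable_continuous c1)
      show "continuous_on (UNIV \<times> cbox (p - 1) y) (\<lambda>(t, s). f12 (s, t))"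
        unfolding case_prod_unfold
        by (intro continuous_on_compose2[OF cont] continuous_intros) auto
    qed auto
    moreover have "((\<lambda>t. f (y, t) - f (p - 1, t)) has_vector_derivative f2 (y, q) - f2 (p - 1, q)) (at q)"
      by (intro derivative_intros has_grad_slices(2)[OF f])
    ultimately show ?thesis
      using that by (auto simp: ftc intro: vector_derivative_unique_at)
  qed
  \<comment> \<open>The base point \<open>p - 1\<close> lies to the left of \<open>p\<close>, so
    that \<open>p\<close> is interior to the interval on which both derivatives in \<open>y\<close>
    are compared.\<close>
  have "((\<lambda>y. integral {p - 1..y} (\<lambda>s. f12 (s, q))) has_vector_derivative f12 (p, q)) (at p within {p - 1..p + 1})"
    by (intro integral_has_vector_derivative c12) auto
  moreover have "((\<lambda>y. f2 (y, q) - f2 (p - 1, q)) has_vector_derivative f21 (p, q)) (at p within {p - 1..p + 1})"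
    using has_vector_derivative_diff[OF has_grad_slices(1)[OF f2] has_vector_derivative_const] by simp
  then have "((\<lambda>y. integral {p - 1..y} (\<lambda>s. f12 (s, q))) has_vector_derivative f21 (p, q)) (at p within {p - 1..p + 1})"
    by (rule has_vector_derivative_transform[rotated 2]) (auto simp: f2_eq)
  ultimately show ?thesis unfolding x
    by (intro vector_derivative_unique_within_closed_interval[of "p - 1" "p + 1" p]) auto
qed

section \<open>Integrals of compactly supported derivatives\<close>

lemma integrable_continuous_compact_support:
  fixes f :: "'a::euclidean_space \<Rightarrow> 'b::{banach, second_countable_topology}"
  assumes "continuous_on UNIV f" "compact K" "\<And>x. x \<notin> K \<Longrightarrow> f x = 0"
  shows "integrable lborel f"
proof -
  have "(\<lambda>x. indicator K x *\<^sub>R f x) = f" using assms(3) by (auto simp: indicator_def)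
  with borel_integrable_compact[OF assms(2) continuous_on_subset[OF assms(1)]] show ?thesis by simp
qed

lemma integral_derivative_compact_support:
  fixes f :: "real \<Rightarrow> 'a::euclidean_space"
  assumes f: "\<And>x. (f has_vector_derivative f' x) (at x)" and cont: "continuous_on UNIV f'"
    and K: "compact K" "\<And>x. x \<notin> K \<Longrightarrow> f x = 0 \<and> f' x = 0"
  shows "(LINT x|lborel. f' x) = 0"
proof -
  obtain a where a: "K \<subseteq> {-a..a}" 
    using bounded_subset_cbox_symmetric[OF compact_imp_bounded[OF K(1)]] by auto
  \<comment> \<open>The margin 1 puts both endpoints outside \<open>K\<close>; the absolute value
    keeps the interval nonempty even if \<open>K\<close> is empty and \<open>a\<close> is
    negative.\<close>
  define b where "b = \<bar>a\<bar> + 1"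
  have b: "K \<subseteq> {-b<..<b}" "-b \<le> b" using a by (force simp: b_def)+
  have "x \<in> {-b..b}" if "x \<in> K" for x using subsetD[OF b(1) that] by simp
  then have "(\<lambda>x. indicator {-b..b} x *\<^sub>R f' x) = f'"
    using K(2) by (intro ext) (metis indicator_simps scaleR_one scaleR_zero_right)
  moreover have "(LINT x|lborel. indicator {-b..b} x *\<^sub>R f' x) = f b - f (-b)"
    by (rule integral_FTC_atLeastAtMost[OF b(2) has_vector_derivative_at_within[OF f] continuous_on_subset[OF cont]]) simp
  moreover have "b \<notin> K" "- b \<notin> K" using b(1) by auto
  then have "f b = 0" "f (-b) = 0" using K(2) by auto
  ultimately show ?thesis by simp
qed

text \<open>By Fubini each partial derivative may be integrated first along its own variable, where
  every slice contributes zero by the one-dimensional case; the projections of \<open>K\<close>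
  contain the supports of the slices. This is the divergence theorem without boundary terms.\<close>

lemma integral_grad_compact_support:
  fixes f :: "pt \<Rightarrow> 'a::euclidean_space"
  assumes f: "\<And>x. has_grad f (f1 x) (f2 x) x" and cont: "continuous_on UNIV f1" "continuous_on UNIV f2"
    and K: "compact K" "\<And>x. x \<notin> K \<Longrightarrow> f x = 0"
  shows "integrable lborel f1" "integrable lborel f2" "(LINT x|lborel. f1 x) = 0" "(LINT x|lborel. f2 x) = 0"
proof -
  note z = grad_zero_off[OF compact_imp_closed[OF K(1)] K(2) _ f]
  show i: "integrable lborel f1" "integrable lborel f2"
    using integrable_continuous_compact_support[OF cont(1) K(1)]
      integrable_continuous_compact_support[OF cont(2) K(1)] z by auto
  have K': "compact (fst ` K)" "compact (snd ` K)"
    by (auto intro!: compact_continuous_image K continuous_intros)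
  have out: "f (s, t) = 0 \<and> f1 (s, t) = 0 \<and> f2 (s, t) = 0" if "s \<notin> fst ` K \<or> t \<notin> snd ` K" for s t
  proof -
    have "(s, t) \<notin> K" using that by force
    then show ?thesis using z K(2) by simp
  qed
  have "(LINT s|lborel. f1 (s, t)) = 0" for t
    by (rule integral_derivative_compact_support[OF has_grad_slices(1)[OF f] _ K'(1)])
      (use out in \<open>auto intro!: continuous_on_compose2[OF cont(1)] continuous_intros\<close>)
  then show "(LINT x|lborel. f1 x) = 0"
    using lborel_pair.integral_snd[of "\<lambda>s t. f1 (s, t)"] i(1) by (simp add: lborel_prod)
  have "(LINT t|lborel. f2 (s, t)) = 0" for s
    by (rule integral_derivative_compact_support[OF has_grad_slices(2)[OF f] _ K'(2)])
      (use out in \<open>auto intro!: continuous_on_compose2[OF cont(2)] continuous_intros\<close>)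
  then show "(LINT x|lborel. f2 x) = 0"
    using lborel_pair.integral_fst[of "\<lambda>s t. f2 (s, t)"] i(2) by (simp add: lborel_prod)
qed

section \<open>The first zero of the Bessel function\<close>

lemma summable_bessel_powser: "summable (\<lambda>k. inverse ((fact k)\<^sup>2) * y ^ k)" for y :: real
proof (rule summable_comparison_test[OF _ summable_exp[of "\<bar>y\<bar>"]], intro exI allI impI)
  fix k :: nat
  have "inverse ((fact k)\<^sup>2) \<le> (inverse (fact k) :: real)"
    by (intro le_imp_inverse_le) (simp_all add: power2_eq_square)
  then show "norm (inverse ((fact k)\<^sup>2) * y ^ k) \<le> inverse (fact k) * \<bar>y\<bar> ^ k"
    by (simp add: abs_mult power_abs mult_right_mono)
qed

text \<open>As a function of \<open>- (x\<^sup>2 / 4)\<close> the series is an ordinary power series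
  with coefficients \<open>1 / (k!)\<^sup>2\<close>, dominated by the exponential series. Continuity
  and the sign at \<open>x\<^sup>2 = 8\<close> are read off from this form.\<close>

lemma BesselJ0_powser: "BesselJ0 x = (\<Sum>k. inverse ((fact k)\<^sup>2) * (- (x\<^sup>2 / 4)) ^ k)"
proof -
  have "(- 1) ^ k * (x / 2) ^ (2 * k) = (- (x\<^sup>2 / 4)) ^ k" for k
    by (subst power_minus[of "x\<^sup>2 / 4"]) (simp add: power_mult power_divide)
  then have "(- 1) ^ k * (x / 2) ^ (2 * k) / (fact k)\<^sup>2 = inverse ((fact k)\<^sup>2) * (- (x\<^sup>2 / 4)) ^ k" for k
    by (metis divide_inverse mult.commute)
  then show ?thesis unfolding BesselJ0_def by presburger
qed

lemma continuous_BesselJ0: "continuous_on S BesselJ0"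
proof -
  have "isCont (\<lambda>y::real. \<Sum>k. inverse ((fact k)\<^sup>2) * y ^ k) y" for y
    by (rule isCont_powser[OF summable_bessel_powser[of "\<bar>y\<bar> + 1"]]) simp
  then have "continuous_on UNIV (\<lambda>y::real. \<Sum>k. inverse ((fact k)\<^sup>2) * y ^ k)"
    by (intro continuous_at_imp_continuous_on) auto
  then have "continuous_on S (\<lambda>x::real. \<Sum>k. inverse ((fact k)\<^sup>2) * (- (x\<^sup>2 / 4)) ^ k)"
    by (rule continuous_on_compose2) (auto intro!: continuous_intros)
  then show ?thesis by (simp add: BesselJ0_powser[abs_def])
qed

text \<open>Here 36 is \<open>(3!)\<^sup>2\<close>, and every further factor is at least
  \<open>4\<^sup>2\<close>. This makes the tail of the Bessel series geometric.\<close>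

lemma fact_plus_3_ge: "36 * 16 ^ k \<le> (fact (k + 3) :: real)\<^sup>2"
proof (induction k)
  case (Suc k)
  have "(fact (Suc k + 3) :: real)\<^sup>2 = (real k + 4)\<^sup>2 * (fact (k + 3))\<^sup>2"
  proof -
    have "(fact (Suc k + 3) :: real) = (real k + 4) * fact (k + 3)"
      using fact_Suc[of "k + 3", where ?'a = real] by (simp del: fact_Suc)
    then show ?thesis by (simp only: power_mult_distrib)
  qed
  also have "\<dots> \<ge> 16 * (36 * 16 ^ k)"
    using Suc by (intro mult_mono) (auto simp: power2_eq_square algebra_simps)
  finally show ?case by simp
qed (simp add: fact_numeral)

text \<open>At \<open>x\<^sup>2 / 4 = 2\<close> the first three terms of the series cancel.\<close>

lemma BesselJ0_sqrt_8: "BesselJ0 (sqrt 8) \<le> 0"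
proof -
  define a :: "nat \<Rightarrow> real" where "a k = inverse ((fact k)\<^sup>2) * (- 2) ^ k" for k
  have J: "BesselJ0 (sqrt 8) = (\<Sum>k. a k)"
    by (simp add: BesselJ0_powser a_def)
  have sa: "summable a" unfolding a_def by (rule summable_bessel_powser)
  \<comment> \<open>The first tail term is \<open>- 8 / 36\<close>, which the correction at
    \<open>k = 0\<close> reproduces exactly. The later terms are taken in absolute value, with ratio
    2/16. The bounds sum to \<open>(8/36) * (8/7) - 16/36 = - 4/21\<close>, so the tail is
    negative.\<close>
  have "a (k + 3) \<le> (8 / 36) * (1 / 8) ^ k - (if k = 0 then 16 / 36 else 0)" for k
  proof (cases "k = 0")
    case False
    have "a (k + 3) \<le> \<bar>a (k + 3)\<bar>" by simp
    also have "\<dots> = 8 * 2 ^ k / (fact (k + 3))\<^sup>2"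
      by (simp add: a_def abs_mult power_abs power_add field_simps del: fact_Suc)
    also have "\<dots> \<le> 8 * 2 ^ k / (36 * 16 ^ k)"
      by (intro divide_left_mono fact_plus_3_ge) auto
    also have "\<dots> = (8 / 36) * (1 / 8) ^ k"
    proof -
      have "(16::real) ^ k = 2 ^ k * 8 ^ k" by (simp flip: power_mult_distrib)
      then show ?thesis by (simp add: field_simps power_divide)
    qed
    finally show ?thesis using False by simp
  qed (simp add: a_def fact_numeral)
  moreover have "(\<lambda>k. a (k + 3)) sums ((\<Sum>k. a k) - (\<Sum>k<3. a k))"
    using sa by (subst sums_iff_shift) (simp add: summable_sums)
  moreover have "(\<lambda>k. (8 / 36) * (1 / 8 :: real) ^ k - (if k = 0 then 16 / 36 else 0)) sums (8 / 36 * (1 / (1 - 1 / 8)) - 16 / 36)"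
    using sums_single[of 0 "\<lambda>_. 16 / 36 :: real"]
    by (intro sums_diff sums_mult geometric_sums) (auto simp: if_distrib)
  ultimately have "(\<Sum>k. a k) - (\<Sum>k<3. a k) \<le> 8 / 36 * (1 / (1 - 1 / 8)) - 16 / 36"
    by (rule sums_le)
  moreover have "(\<Sum>k<3. a k) = 0" by (simp add: a_def numeral_3_eq_3 fact_numeral)
  ultimately show ?thesis by (simp add: J)
qed

text \<open>The function is 1 at 0 and nonpositive at \<open>sqrt 8\<close>, so the intermediate
  value theorem gives a positive zero up to \<open>sqrt 8\<close>, which bounds the infimum of all
  positive zeros.\<close>

lemma j0_first_zero_bound: "j0_first_zero\<^sup>2 \<le> 8"
proof -
  have "BesselJ0 0 = 1"
    using powser_zero[of "\<lambda>k. inverse ((fact k)\<^sup>2) :: real"] by (simp add: BesselJ0_powser)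
  with IVT2'[of BesselJ0 "sqrt 8" 0 0] BesselJ0_sqrt_8 continuous_BesselJ0
  obtain z where z: "0 \<le> z" "z \<le> sqrt 8" "BesselJ0 z = 0" by auto
  then have z_mem: "z \<in> {x. 0 < x \<and> BesselJ0 x = 0}"
    using \<open>BesselJ0 0 = 1\<close> by (cases "z = 0") auto
  have "j0_first_zero \<le> z" unfolding j0_first_zero_def
    by (rule cInf_lower[OF z_mem]) (auto intro!: bdd_belowI[of _ 0])
  moreover have "0 \<le> j0_first_zero" unfolding j0_first_zero_def
    using z_mem by (intro cInf_greatest) auto
  ultimately have "j0_first_zero\<^sup>2 \<le> (sqrt 8)\<^sup>2" using z by (intro power_mono) auto
  then show ?thesis by simp
qed

section \<open>Convergence of squared norms\<close>

lemma integrable_cmod_diff_sq: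
  assumes "f \<in> borel_measurable M" "integrable M (\<lambda>x. (cmod (f x))\<^sup>2)"
    and "g \<in> borel_measurable M" "integrable M (\<lambda>x. (cmod (g x))\<^sup>2)"
  shows "integrable M (\<lambda>x. (cmod (f x - g x))\<^sup>2)"
proof (rule Bochner_Integration.integrable_bound)
  show "integrable M (\<lambda>x. 2 * (cmod (f x))\<^sup>2 + 2 * (cmod (g x))\<^sup>2)" using assms by simp
  show "(\<lambda>x. (cmod (f x - g x))\<^sup>2) \<in> borel_measurable M" using assms by measurable
  have "(cmod (f x - g x))\<^sup>2 \<le> 2 * (cmod (f x))\<^sup>2 + 2 * (cmod (g x))\<^sup>2" for x
    \<comment> \<open>By the parallelogram law, the gap in this inequality is
      \<open>|f + g|\<^sup>2\<close>.\<close>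
    unfolding cmod_power2 using sum_squares_ge_zero[of "Re (f x + g x)" "Im (f x + g x)"]
    by (simp add: power2_eq_square algebra_simps)
  then show "AE x in M. norm ((cmod (f x - g x))\<^sup>2) \<le> norm (2 * (cmod (f x))\<^sup>2 + 2 * (cmod (g x))\<^sup>2)"
    by (intro AE_I2) (simp add: abs_le_iff)
qed

text \<open>A pointwise inequality with a free parameter \<open>e\<close> is integrated: it bounds
  the error by \<open>(1 + 1 / e) * d n + e * G\<close>. First \<open>e\<close> makes the second
  term small, then \<open>n\<close> the first.\<close>

lemma integral_cmod_sq_tendsto:
  fixes f :: "nat \<Rightarrow> 'a \<Rightarrow> complex"
  assumes f: "\<And>n. f n \<in> borel_measurable M" "\<And>n. integrable M (\<lambda>x. (cmod (f n x))\<^sup>2)"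
    and g: "g \<in> borel_measurable M" "integrable M (\<lambda>x. (cmod (g x))\<^sup>2)"
    and lim: "(\<lambda>n. LINT x|M. (cmod (f n x - g x))\<^sup>2) \<longlonglongrightarrow> 0"
  shows "(\<lambda>n. LINT x|M. (cmod (f n x))\<^sup>2) \<longlonglongrightarrow> (LINT x|M. (cmod (g x))\<^sup>2)"
proof -
  define G where "G = (LINT x|M. (cmod (g x))\<^sup>2)"
  define d where "d n = (LINT x|M. (cmod (f n x - g x))\<^sup>2)" for n
  have "G \<ge> 0" by (simp add: G_def)
  note int = f g integrable_cmod_diff_sq[OF f g]
  have pw: "\<bar>(cmod a)\<^sup>2 - (cmod b)\<^sup>2\<bar> \<le> (1 + 1 / e) * (cmod (a - b))\<^sup>2 + e * (cmod b)\<^sup>2" if "e > 0" for a b e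
  proof -
    have "\<bar>cmod a - cmod b\<bar> \<le> cmod (a - b)" by (simp add: norm_triangle_ineq3)
    then have "\<bar>(cmod a)\<^sup>2 - (cmod b)\<^sup>2\<bar> \<le> cmod (a - b) * (cmod (a - b) + 2 * cmod b)"
      unfolding power2_eq_square square_diff_square_factored abs_mult
      by (subst mult.commute) (intro mult_mono, auto)
    \<comment> \<open>Young's inequality, from the square of \<open>|a - b| - e |b|\<close> divided
      by \<open>e\<close>.\<close>
    also have "2 * cmod (a - b) * cmod b \<le> (1 / e) * (cmod (a - b))\<^sup>2 + e * (cmod b)\<^sup>2"
      using zero_le_power2[of "cmod (a - b) - e * cmod b"] that
      by (simp add: field_simps power2_eq_square)
    then have "cmod (a - b) * (cmod (a - b) + 2 * cmod b) \<le> (1 + 1 / e) * (cmod (a - b))\<^sup>2 + e * (cmod b)\<^sup>2"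
      by (simp add: algebra_simps power2_eq_square)
    finally show ?thesis .
  qed
  have bound: "\<bar>(LINT x|M. (cmod (f n x))\<^sup>2) - G\<bar> \<le> (1 + 1 / e) * d n + e * G" if "e > 0" for n e
  proof -
    have "\<bar>(LINT x|M. (cmod (f n x))\<^sup>2) - G\<bar> = \<bar>LINT x|M. (cmod (f n x))\<^sup>2 - (cmod (g x))\<^sup>2\<bar>"
      unfolding G_def using int by simp
    also have "\<dots> \<le> (LINT x|M. \<bar>(cmod (f n x))\<^sup>2 - (cmod (g x))\<^sup>2\<bar>)"
      using integral_norm_bound[of M "\<lambda>x. (cmod (f n x))\<^sup>2 - (cmod (g x))\<^sup>2"] by simp
    also have "\<dots> \<le> (LINT x|M. (1 + 1 / e) * (cmod (f n x - g x))\<^sup>2 + e * (cmod (g x))\<^sup>2)"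
      using int pw[OF that] by (intro integral_mono) auto
    also have "\<dots> = (1 + 1 / e) * d n + e * G"
      unfolding G_def d_def using int by simp
    finally show ?thesis .
  qed
  show ?thesis unfolding G_def[symmetric]
  proof (rule LIMSEQ_I)
    fix r :: real assume "r > 0"
    \<comment> \<open>The summand 1 avoids division by zero when \<open>G = 0\<close> and makes
      \<open>e * G < r / 2\<close> strict.\<close>
    define e where "e = r / (2 * (G + 1))"
    have "e > 0" "e * G < r / 2" using \<open>r > 0\<close> \<open>G \<ge> 0\<close> by (auto simp: e_def field_simps)
    have "(\<lambda>n. (1 + 1 / e) * d n) \<longlonglongrightarrow> 0"
      using tendsto_mult_left[OF lim, of "1 + 1 / e"] by (simp add: d_def)
    then have "eventually (\<lambda>n. (1 + 1 / e) * d n < r / 2) sequentially"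
      using \<open>r > 0\<close> by (intro order_tendstoD) auto
    then obtain N where "\<And>n. n \<ge> N \<Longrightarrow> (1 + 1 / e) * d n < r / 2"
      by (auto simp: eventually_sequentially)
    then show "\<exists>N. \<forall>n\<ge>N. norm ((LINT x|M. (cmod (f n x))\<^sup>2) - G) < r"
      using bound[OF \<open>e > 0\<close>] \<open>e * G < r / 2\<close> by (intro exI[of _ N]) (smt (verit) field_sum_of_halves real_norm_def)
  qed
qed

section \<open>Iterated differentiability\<close>

lemma Ck_Suc_has_grad:
  "Ck (Suc n) f \<longleftrightarrow> (\<exists>f1 f2. (\<forall>x. has_grad f (f1 x) (f2 x) x) \<and> Ck n f1 \<and> Ck n f2)"
  by (simp add: has_grad_def scaleR_conv_of_real)

lemma Ck_SucI:
  "(\<And>x. has_grad f (f1 x) (f2 x) x) \<Longrightarrow> Ck n f1 \<Longrightarrow> Ck n f2 \<Longrightarrow> Ck (Suc n) f"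
  unfolding Ck_Suc_has_grad by blast

lemma Ck_imp_continuous: "Ck n f \<Longrightarrow> continuous_on UNIV f"
proof (cases n)
  case (Suc m)
  assume "Ck n f"
  then show ?thesis unfolding Suc Ck_Suc_has_grad using has_grad_continuous by blast
qed simp

lemma Ck_SucD: "Ck (Suc n) f \<Longrightarrow> Ck n f"
proof (induction n arbitrary: f)
  case 0
  then show ?case using Ck_imp_continuous[OF 0] by simp
next
  case (Suc n)
  then show ?case unfolding Ck_Suc_has_grad[of "Suc n"] Ck_Suc_has_grad[of n] by blast
qed

lemma Ck_const: "Ck n (\<lambda>x. c)"
proof (induction n arbitrary: c)
  case (Suc n)
  show ?case by (rule Ck_SucI[OF has_grad_const]) (rule Suc)+
qed simp

lemma Ck_add: "Ck n f \<Longrightarrow> Ck n g \<Longrightarrow> Ck n (\<lambda>x. f x + g x)"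
proof (induction n arbitrary: f g)
  case (Suc n)
  then obtain f1 f2 g1 g2 where
    "\<And>x. has_grad f (f1 x) (f2 x) x" "Ck n f1" "Ck n f2"
    "\<And>x. has_grad g (g1 x) (g2 x) x" "Ck n g1" "Ck n g2"
    unfolding Ck_Suc_has_grad by blast
  then show ?case unfolding Ck_Suc_has_grad
    by (intro exI[of _ "\<lambda>x. f1 x + g1 x"] exI[of _ "\<lambda>x. f2 x + g2 x"] conjI allI has_grad_add Suc.IH)
qed (auto intro: continuous_on_add)

text \<open>The product rule places each factor itself next to the derivatives of the other, so the
  induction also uses that \<open>Ck\<close> at one order implies \<open>Ck\<close> at the order
  below.\<close>

lemma Ck_mult: "Ck n f \<Longrightarrow> Ck n g \<Longrightarrow> Ck n (\<lambda>x. f x * g x)"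
proof (induction n arbitrary: f g)
  case (Suc n)
  then obtain f1 f2 g1 g2 where
    "\<And>x. has_grad f (f1 x) (f2 x) x" "Ck n f1" "Ck n f2"
    "\<And>x. has_grad g (g1 x) (g2 x) x" "Ck n g1" "Ck n g2"
    unfolding Ck_Suc_has_grad by blast
  then show ?case unfolding Ck_Suc_has_grad
    by (intro exI[of _ "\<lambda>x. f1 x * g x + f x * g1 x"] exI[of _ "\<lambda>x. f2 x * g x + f x * g2 x"]
        conjI allI has_grad_mult Ck_add Suc.IH Ck_SucD[OF Suc.prems(1)] Ck_SucD[OF Suc.prems(2)])
qed (auto intro: continuous_on_mult)

lemma has_grad_of_real: "has_grad f a b x \<Longrightarrow> has_grad (\<lambda>x. complex_of_real (f x)) (of_real a) (of_real b) x"
  by (rule has_grad_bounded_linear[OF bounded_linear_of_real])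

lemma Ck_fst: "Ck n (\<lambda>x. of_real (fst x))" and Ck_snd: "Ck n (\<lambda>x. of_real (snd x))"
proof -
  have "continuous_on UNIV (\<lambda>x. complex_of_real (fst x))" "continuous_on UNIV (\<lambda>x. complex_of_real (snd x))"
    by (auto intro!: continuous_intros)
  then show "Ck n (\<lambda>x. of_real (fst x))" "Ck n (\<lambda>x. of_real (snd x))"
    by (cases n; simp only: Ck.simps(1) Ck_SucI[OF has_grad_of_real[OF has_grad_fst] Ck_const Ck_const]
      Ck_SucI[OF has_grad_of_real[OF has_grad_snd] Ck_const Ck_const])+
qed

text \<open>The sequence \<open>D\<close> lists the successive derivatives of one function. The
  chain rule moves from \<open>D k\<close> to \<open>D (Suc k)\<close>, so an induction on
  \<open>n\<close> with \<open>k\<close> arbitrary never leaves the family.\<close>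

lemma Ck_compose_real:
  fixes D :: "nat \<Rightarrow> real \<Rightarrow> real"
  assumes D: "\<And>k t. (D k has_real_derivative D (Suc k) t) (at t)"
    and s: "\<And>x. has_grad s (s1 x) (s2 x) x"
    and s12: "\<And>n. Ck n (\<lambda>x. of_real (s1 x))" "\<And>n. Ck n (\<lambda>x. of_real (s2 x))"
  shows "Ck n (\<lambda>x. of_real (D k (s x)))"
proof (induction n arbitrary: k)
  case 0
  have "continuous_on UNIV (D k)"
    using D by (meson DERIV_continuous_on DERIV_subset subset_UNIV)
  then have "continuous_on UNIV (\<lambda>x. D k (s x))"
    by (rule continuous_on_compose2) (auto intro: has_grad_continuous s)
  then show ?case by (auto intro!: continuous_intros)
next
  case (Suc n)
  have "has_grad (\<lambda>x. complex_of_real (D k (s x))) (of_real (D (Suc k) (s x)) * of_real (s1 x))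
      (of_real (D (Suc k) (s x)) * of_real (s2 x)) x" for x
    using has_grad_of_real[OF has_grad_chain[OF D s]] by simp
  moreover have "Ck n (\<lambda>x. of_real (D (Suc k) (s x)) * of_real (s1 x))"
    "Ck n (\<lambda>x. of_real (D (Suc k) (s x)) * of_real (s2 x))"
    by (intro Ck_mult Suc.IH s12)+
  ultimately show ?case by (rule Ck_SucI)
qed

section \<open>Smooth functions of the squared radius\<close>

definition sqn :: "pt \<Rightarrow> real" where "sqn x = (fst x)\<^sup>2 + (snd x)\<^sup>2"

lemma has_grad_sqn: "has_grad sqn (2 * fst x) (2 * snd x) x"
proof -
  have "has_grad (\<lambda>x. fst x * fst x + snd x * snd x) (2 * fst x) (2 * snd x) x"
    by (rule has_grad_eq_rhs[OF has_grad_add[OF has_grad_mult[OF has_grad_fst has_grad_fst] has_grad_mult[OF has_grad_snd has_grad_snd]]]) auto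
  then show ?thesis by (simp add: sqn_def[abs_def] power2_eq_square)
qed

lemma continuous_sqn: "continuous_on S sqn"
  using has_grad_continuous[OF has_grad_sqn] .

text \<open>The affine argument covers the inner cutoff (\<open>m = 1\<close>), the outer cutoff
  (\<open>m = - 1\<close>) and the exponential weight.\<close>

lemma Ck_compose_sqn:
  fixes D :: "nat \<Rightarrow> real \<Rightarrow> real"
  assumes D: "\<And>k t. (D k has_real_derivative D (Suc k) t) (at t)"
  shows "Ck n (\<lambda>x. of_real (D k (m * sqn x + c)))"
proof (rule Ck_compose_real[where D = D, OF D])
  show "has_grad (\<lambda>x. m * sqn x + c) (2 * m * fst x) (2 * m * snd x) x" for x
    by (rule has_grad_eq_rhs[OF has_grad_add[OF has_grad_mult[OF has_grad_const has_grad_sqn] has_grad_const]]) auto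
  show "Ck n (\<lambda>x. of_real (2 * m * fst x))" "Ck n (\<lambda>x. of_real (2 * m * snd x))" for n
    using Ck_mult[OF Ck_const Ck_fst] Ck_mult[OF Ck_const Ck_snd] by simp_all
qed

section \<open>Test functions\<close>

lemma tendsto_poly_mult_exp_neg: "((\<lambda>y. poly p y * exp (- y)) \<longlongrightarrow> (0::real)) at_top"
proof -
  have "((\<lambda>y. \<Sum>i\<le>degree p. coeff p i * (y ^ i / exp y)) \<longlongrightarrow> (\<Sum>i\<le>degree p. coeff p i * 0)) at_top"
    by (intro tendsto_sum tendsto_mult tendsto_const tendsto_power_div_exp_0)
  then show ?thesis
    by (simp add: poly_altdef sum_distrib_right exp_minus divide_inverse mult.assoc)
qed

text \<open>The derivatives of \<open>exp (- 1 / t)\<close> are \<open>p\<^sub>k (1 / t) exp (- 1 / t)\<close> with \<open>p\<^sub>k\<^sub>+\<^sub>1 (y) = y\<^sup>2 (p\<^sub>k (y) - p\<^sub>k' (y))\<close>.\<close>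

fun flat_poly :: "nat \<Rightarrow> real poly" where
  "flat_poly 0 = 1"
| "flat_poly (Suc k) = [:0, 0, 1:] * (flat_poly k - pderiv (flat_poly k))"

definition flat :: "nat \<Rightarrow> real \<Rightarrow> real" where
  "flat k t = (if t > 0 then poly (flat_poly k) (1 / t) * exp (- (1 / t)) else 0)"

lemma flat_deriv: "(flat k has_real_derivative flat (Suc k) t) (at t)"
proof -
  consider "t > 0" | "t < 0" | "t = 0" by linarith
  then show ?thesis
  proof cases
    case 1
    have "((\<lambda>t. poly (flat_poly k) (1 / t) * exp (- (1 / t))) has_real_derivative flat (Suc k) t) (at t)"
      using 1 by (auto intro!: derivative_eq_intros DERIV_chain2[OF poly_DERIV] simp: flat_def power2_eq_square algebra_simps)
    then show ?thesis
      by (rule has_field_derivative_transform_within_open[where S="{0<..}"]) (use 1 in \<open>auto simp: flat_def\<close>)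
  next
    case 2
    have "((\<lambda>t. 0) has_real_derivative flat (Suc k) t) (at t)"
      using 2 by (simp add: flat_def)
    then show ?thesis
      by (rule has_field_derivative_transform_within_open[where S="{..<0}"]) (use 2 in \<open>auto simp: flat_def\<close>)
  next
    case 3
    \<comment> \<open>Only the point 0 needs a limit. The extra factor \<open>[:0, 1:]\<close> is
      the \<open>1 / h\<close> of the difference quotient, which tends to 0 because the exponential
      beats every polynomial.\<close>
    have "((\<lambda>y. poly (flat_poly k * [:0, 1:]) (inverse y) * exp (- inverse y)) \<longlongrightarrow> 0) (at_right 0)"
      by (rule filterlim_compose[OF tendsto_poly_mult_exp_neg filterlim_inverse_at_top_right])
    then have r: "((\<lambda>h. (flat k h - flat k 0) / (h - 0)) \<longlongrightarrow> 0) (at_right 0)"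
      by (rule Lim_transform_eventually)
        (auto simp: eventually_at_right_field flat_def divide_simps intro!: exI[of _ 1])
    have l: "((\<lambda>h. (flat k h - flat k 0) / (h - 0)) \<longlongrightarrow> 0) (at_left 0)"
      by (rule Lim_transform_eventually[OF tendsto_const])
        (auto simp: eventually_at_left_field flat_def intro!: exI[of _ "-1"])
    show ?thesis unfolding 3 has_field_derivative_iff
      using filterlim_split_at[OF l r] by (simp add: flat_def)
  qed
qed

lemma flat_0_pos: "flat 0 t > 0 \<longleftrightarrow> t > 0" and flat_0_nonneg: "flat 0 t \<ge> 0"
  by (auto simp: flat_def)

lemma annulus_sqn: "annulus \<rho> R = {x. \<rho>\<^sup>2 < sqn x \<and> sqn x < R\<^sup>2}"
  by (simp add: annulus_def sqn_def)

lemma compact_closed_ring: "compact {x. a \<le> sqn x \<and> sqn x \<le> b}"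
proof -
  have "closed {x. a \<le> sqn x \<and> sqn x \<le> b}"
    by (intro closed_Collect_conj closed_Collect_le continuous_sqn continuous_on_const)
  moreover have "{x. a \<le> sqn x \<and> sqn x \<le> b} \<subseteq> cball 0 (sqrt b)"
    by (auto simp: sqn_def norm_prod_def)
  ultimately show ?thesis
    by (meson bounded_cball bounded_subset compact_eq_bounded_closed)
qed

text \<open>The product of a cutoff in \<open>sqn x - a\<close> and one in \<open>b - sqn x\<close>
  is supported in the closed ring between \<open>a\<close> and \<open>b\<close>. It shows that the
  infimum defining the ground state energy runs over a nonempty set.\<close>

lemma test_fun_annulus_exists:
  assumes "0 < \<rho>" "\<rho> < R"
  obtains \<phi> x where "test_fun (annulus \<rho> R) \<phi>" "x \<in> annulus \<rho> R" "\<phi> x \<noteq> 0"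
proof -
  \<comment> \<open>The points dividing the interval from \<open>\<rho>\<^sup>2\<close> to
    \<open>R\<^sup>2\<close> into thirds.\<close>
  define a b where "a = (2 * \<rho>\<^sup>2 + R\<^sup>2) / 3" and "b = (\<rho>\<^sup>2 + 2 * R\<^sup>2) / 3"
  have "\<rho>\<^sup>2 < R\<^sup>2" using assms by (intro power_strict_mono) auto
  then have ab: "\<rho>\<^sup>2 < a" "a < b" "b < R\<^sup>2" by (auto simp: a_def b_def)
  define \<phi> :: "pt \<Rightarrow> complex" where
    "\<phi> = (\<lambda>x. of_real (flat 0 (1 * sqn x + (- a))) * of_real (flat 0 ((- 1) * sqn x + b)))"
  have "smooth2 \<phi>" unfolding smooth2_def \<phi>_def
    by (intro allI Ck_mult Ck_compose_sqn flat_deriv)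
  let ?C = "{x. a \<le> sqn x \<and> sqn x \<le> b}"
  have "{x. \<phi> x \<noteq> 0} \<subseteq> ?C"
    using flat_0_pos flat_0_nonneg by (auto simp: \<phi>_def less_le)
  then have sub: "closure {x. \<phi> x \<noteq> 0} \<subseteq> ?C"
    by (rule closure_minimal) (rule compact_imp_closed[OF compact_closed_ring])
  moreover have "compact (closure {x. \<phi> x \<noteq> 0})"
    unfolding compact_closure
    by (rule bounded_subset[OF compact_imp_bounded[OF compact_closed_ring]]) (rule \<open>{x. \<phi> x \<noteq> 0} \<subseteq> ?C\<close>)
  moreover have "?C \<subseteq> annulus \<rho> R" using ab by (auto simp: annulus_sqn)
  ultimately have "test_fun (annulus \<rho> R) \<phi>"
    using \<open>smooth2 \<phi>\<close> unfolding test_fun_def by simp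
  moreover have "0 \<le> (a + b) / 2"
    unfolding a_def b_def by (intro divide_nonneg_nonneg add_nonneg_nonneg mult_nonneg_nonneg) auto
  then have "sqn (sqrt ((a + b) / 2), 0) = (a + b) / 2"
    by (simp add: sqn_def)
  then have "(sqrt ((a + b) / 2), 0) \<in> annulus \<rho> R" "\<phi> (sqrt ((a + b) / 2), 0) \<noteq> 0"
    using ab unfolding annulus_sqn by (auto simp: \<phi>_def flat_def)
  ultimately show ?thesis using that by blast
qed

section \<open>Test functions and their partial derivatives\<close>

text \<open>\<open>Ck\<close> only asserts that some partial derivatives exist; uniqueness of the
  derivative identifies them with \<open>pd1\<close> and \<open>pd2\<close>, independently of the
  order \<open>n\<close>.\<close>

lemma test_fun_has_grad:
  assumes "smooth2 \<phi>"
  shows "has_grad \<phi> (pd1 \<phi> x) (pd2 \<phi> x) x" "Ck n (pd1 \<phi>)" "Ck n (pd2 \<phi>)"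
proof -
  obtain f1 f2 where f: "\<And>x. has_grad \<phi> (f1 x) (f2 x) x" "Ck n f1" "Ck n f2"
    using assms unfolding smooth2_def by (metis Ck_Suc_has_grad)
  have "pd1 \<phi> x = f1 x" "pd2 \<phi> x = f2 x" for x
    using frechet_derivative_at[OF f(1)[of x, unfolded has_grad_def]]
    by (simp_all add: pd1_def pd2_def fun_eq_iff) (metis (no_types) fst_conv snd_conv scaleR_one scaleR_zero_left add_0 add_0_right)+
  then have "pd1 \<phi> = f1" "pd2 \<phi> = f2" by auto
  then show "has_grad \<phi> (pd1 \<phi> x) (pd2 \<phi> x) x" "Ck n (pd1 \<phi>)" "Ck n (pd2 \<phi>)"
    using f by simp_all
qed

lemma test_fun_support:
  assumes "test_fun \<Omega> \<phi>"
  obtains K where "compact K" "K \<subseteq> \<Omega>" "\<And>x. x \<notin> K \<Longrightarrow> \<phi> x = 0"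
  using assms closure_subset[of "{x. \<phi> x \<noteq> 0}"] unfolding test_fun_def by blast

lemma L2fun_continuous:
  assumes "continuous_on UNIV f" "compact K" "\<And>x. x \<notin> K \<Longrightarrow> f x = 0"
  shows "L2fun f"
proof -
  have "integrable lborel (\<lambda>x. (cmod (f x))\<^sup>2)"
    by (rule integrable_continuous_compact_support[OF _ assms(2)]) (use assms in \<open>auto intro!: continuous_intros\<close>)
  with assms(1) show ?thesis
    unfolding L2fun_def by (auto intro: borel_measurable_continuous_onI)
qed

lemma test_fun_L2:
  assumes "test_fun \<Omega> \<phi>"
  shows "L2fun \<phi>" "L2fun (pd1 \<phi>)" "L2fun (pd2 \<phi>)"
proof -
  have s: "smooth2 \<phi>" using assms by (simp add: test_fun_def)
  obtain K where K: "compact K" "\<And>x. x \<notin> K \<Longrightarrow> \<phi> x = 0" using test_fun_support[OF assms] by metis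
  note z = grad_zero_off[OF compact_imp_closed[OF K(1)] K(2) _ test_fun_has_grad(1)[OF s]]
  show "L2fun \<phi>" "L2fun (pd1 \<phi>)" "L2fun (pd2 \<phi>)"
    by (intro L2fun_continuous[OF _ K(1)] K(2) z Ck_imp_continuous[of 0] test_fun_has_grad[OF s] has_grad_continuous[OF test_fun_has_grad(1)[OF s]]; assumption)+
qed

lemma test_fun_H10: "test_fun \<Omega> \<phi> \<Longrightarrow> H10 \<Omega> \<phi> (pd1 \<phi>) (pd2 \<phi>)"
  unfolding H10_def using test_fun_L2 by (auto simp: L2dist2_def intro!: exI[of _ "\<lambda>_. \<phi>"])

text \<open>A vanishing integral makes \<open>{x. \<phi> x \<noteq> 0}\<close> a null set, but this
  set is open and nonempty.\<close>

lemma integral_cmod_sq_test_fun_nonzero: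
  assumes "test_fun \<Omega> \<phi>" "\<phi> x \<noteq> 0"
  shows "(LINT x:\<Omega>|lborel. (cmod (\<phi> x))\<^sup>2) \<noteq> 0"
proof
  assume *: "(LINT x:\<Omega>|lborel. (cmod (\<phi> x))\<^sup>2) = 0"
  obtain K where K: "K \<subseteq> \<Omega>" "\<And>x. x \<notin> K \<Longrightarrow> \<phi> x = 0" using test_fun_support[OF assms(1)] by metis
  then have "(\<lambda>x. indicator \<Omega> x *\<^sub>R (cmod (\<phi> x))\<^sup>2) = (\<lambda>x. (cmod (\<phi> x))\<^sup>2)"
    by (auto simp: indicator_def fun_eq_iff)
  then have "(LINT x|lborel. (cmod (\<phi> x))\<^sup>2) = 0"
    using * by (simp add: set_lebesgue_integral_def)
  then have "AE x in lborel. (cmod (\<phi> x))\<^sup>2 = 0"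
    using test_fun_L2(1)[OF assms(1)] by (subst (asm) integral_nonneg_eq_0_iff_AE) (auto simp: L2fun_def)
  then have "AE x in lborel. x \<notin> {x. \<phi> x \<noteq> 0}" by eventually_elim simp
  moreover have o: "open {x. \<phi> x \<noteq> 0}"
    using has_grad_continuous[OF test_fun_has_grad(1)] assms(1)
    by (intro open_Collect_neq continuous_on_const) (auto simp: test_fun_def)
  ultimately have "{x. \<phi> x \<noteq> 0} \<in> null_sets lborel"
    by (subst AE_iff_null_sets) auto
  then have "negligible {x. \<phi> x \<noteq> 0}"
    by (simp add: negligible_iff_null_sets null_sets_completionI)
  then show False using open_not_negligible[OF o] assms(2) by blast
qed

section \<open>The Pauli form\<close>

text \<open>Differentiability is required only on a neighbourhood \<open>U\<close> of
  \<open>K\<close>, which admits fields containing the factor \<open>1 / (b - |x|\<^sup>2)\<close>,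
  singular on a circle away from \<open>K\<close>. Off \<open>K\<close> everything is zero, and the
  two open pieces \<open>U\<close> and \<open>- K\<close> cover the plane.\<close>

lemma integral_grad_compact_support_local:
  fixes f :: "pt \<Rightarrow> 'a::euclidean_space"
  assumes U: "open U" "compact K" "K \<subseteq> U"
    and f: "\<And>x. x \<in> U \<Longrightarrow> has_grad f (f1 x) (f2 x) x"
    and cont: "continuous_on U f1" "continuous_on U f2"
    and zero: "\<And>x. x \<notin> K \<Longrightarrow> f x = 0" "\<And>x. x \<notin> K \<Longrightarrow> f1 x = 0" "\<And>x. x \<notin> K \<Longrightarrow> f2 x = 0"
  shows "integrable lborel f1" "integrable lborel f2" "(LINT x|lborel. f1 x) = 0" "(LINT x|lborel. f2 x) = 0"
proof -
  note cK = compact_imp_closed[OF U(2)]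
  have cont': "continuous_on UNIV g" if "continuous_on U g" "\<And>x. x \<notin> K \<Longrightarrow> g x = 0" for g :: "pt \<Rightarrow> 'a"
  proof -
    have "continuous_on (- K) g"
      using that(2) by (subst continuous_on_cong[OF refl, of _ g "\<lambda>_. 0"]) auto
    then have "continuous_on (U \<union> - K) g"
      using that(1) U(1) cK by (intro continuous_on_open_Un) auto
    moreover have "U \<union> - K = UNIV" using U(3) by auto
    ultimately show ?thesis by simp
  qed
  have "has_grad f (f1 x) (f2 x) x" for x
  proof (cases "x \<in> K")
    case True
    then show ?thesis using f U(3) by blast
  next
    case False
    then show ?thesis using has_grad_zero_off[OF cK, of f] zero by simp
  qed
  note * = integral_grad_compact_support[OF this cont'[OF cont(1) zero(2)] cont'[OF cont(2) zero(3)] U(2) zero(1)]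
  show "integrable lborel f1" "integrable lborel f2" "(LINT x|lborel. f1 x) = 0" "(LINT x|lborel. f2 x) = 0"
    by (rule *; assumption)+
qed

lemma has_grad_cmod_sq:
  assumes "has_grad w p q x"
  shows "has_grad (\<lambda>x. (cmod (w x))\<^sup>2) (2 * Re (p * cnj (w x))) (2 * Re (q * cnj (w x))) x"
proof -
  have "has_grad (\<lambda>x. Re (w x * cnj (w x))) (Re (p * cnj (w x) + w x * cnj p)) (Re (q * cnj (w x) + w x * cnj q)) x"
    by (intro has_grad_bounded_linear[OF bounded_linear_Re] has_grad_mult has_grad_bounded_linear[OF bounded_linear_cnj] assms)
  moreover have "(\<lambda>x. Re (w x * cnj (w x))) = (\<lambda>x. (cmod (w x))\<^sup>2)"
    by (simp add: complex_mult_cnj cmod_power2)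
  ultimately show ?thesis by (simp add: algebra_simps)
qed

text \<open>The integrand is minus the Jacobian determinant of \<open>w\<close> and equals half of
  \<open>\<partial>\<^sub>1 Im (w cnj w2) - \<partial>\<^sub>2 Im (w cnj w1)\<close>: the second
  derivatives of \<open>w\<close> cancel by symmetry.\<close>

lemma integral_jacobian_zero:
  fixes w :: "pt \<Rightarrow> complex"
  assumes w: "\<And>x. has_grad w (w1 x) (w2 x) x"
    and C1: "Ck (Suc 0) w1" "Ck (Suc 0) w2"
    and K: "compact K" "\<And>x. x \<notin> K \<Longrightarrow> w x = 0"
  shows "integrable lborel (\<lambda>x. Im (w1 x * cnj (w2 x)))" "(LINT x|lborel. Im (w1 x * cnj (w2 x))) = 0"
proof -
  obtain w11 w12 where w1: "\<And>x. has_grad w1 (w11 x) (w12 x) x" "continuous_on UNIV w11" "continuous_on UNIV w12"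
    using C1(1) unfolding Ck_Suc_has_grad by auto
  obtain w21 w22 where w2: "\<And>x. has_grad w2 (w21 x) (w22 x) x" "continuous_on UNIV w21" "continuous_on UNIV w22"
    using C1(2) unfolding Ck_Suc_has_grad by auto
  note cont = has_grad_continuous[OF w] has_grad_continuous[OF w1(1)] has_grad_continuous[OF w2(1)] w1(2,3) w2(2,3)
  have sym: "w12 x = w21 x" for x by (rule mixed_partials_commute[OF w w1(1) w2(1) w1(3)])
  have p: "has_grad (\<lambda>x. Im (w x * cnj (g x))) (Im (w1 x * cnj (g x) + w x * cnj a)) (Im (w2 x * cnj (g x) + w x * cnj b)) x"
    if "has_grad g a b x" for g a b x
    by (intro has_grad_bounded_linear[OF bounded_linear_Im] has_grad_mult has_grad_bounded_linear[OF bounded_linear_cnj] w that)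
  have z: "w1 x = 0" "w2 x = 0" if "x \<notin> K" for x
    using grad_zero_off[OF compact_imp_closed[OF K(1)] K(2) that w] by auto
  let ?D1 = "\<lambda>x. Im (w1 x * cnj (w2 x) + w x * cnj (w21 x))"
  let ?D2 = "\<lambda>x. Im (w2 x * cnj (w1 x) + w x * cnj (w12 x))"
  have cD: "continuous_on UNIV ?D1" "continuous_on UNIV ?D2"
    "continuous_on UNIV (\<lambda>x. Im (w2 x * cnj (w2 x) + w x * cnj (w22 x)))"
    "continuous_on UNIV (\<lambda>x. Im (w1 x * cnj (w1 x) + w x * cnj (w11 x)))"
    by (intro continuous_intros cont)+
  have D1: "integrable lborel ?D1" "(LINT x|lborel. ?D1 x) = 0"
    using integral_grad_compact_support(1,3)[OF p[OF w2(1)] cD(1,3) K(1)] K(2) by simp_all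
  have D2: "integrable lborel ?D2" "(LINT x|lborel. ?D2 x) = 0"
    using integral_grad_compact_support(2,4)[OF p[OF w1(1)] cD(4,2) K(1)] K(2) by simp_all
  have eq: "Im (w1 x * cnj (w2 x)) = (?D1 x - ?D2 x) / 2" for x
    by (simp add: sym)
  show "integrable lborel (\<lambda>x. Im (w1 x * cnj (w2 x)))"
    unfolding eq using D1(1) D2(1) by (intro integrable_divide Bochner_Integration.integrable_diff)
  show "(LINT x|lborel. Im (w1 x * cnj (w2 x))) = 0"
    unfolding eq using D1 D2 by (simp del: minus_complex.sel times_complex.sel plus_complex.sel complex_cnj)
qed

text \<open>The two middle terms on the right are the divergence of \<open>h \<beta> |u|\<^sup>2 (x, y)\<close>, which comes from the
  commutator of the two components of \<open>hD - A\<close>.\<close>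

lemma magnetic_square_identity:
  fixes p q u :: complex and h \<beta> x y :: real
  shows "(cmod (of_real h * (- \<i>) * p - of_real (\<beta> * (- y)) * u))\<^sup>2
    + (cmod (of_real h * (- \<i>) * q - of_real (\<beta> * x) * u))\<^sup>2
    = 2 * h * \<beta> * (cmod u)\<^sup>2 - 2 * h\<^sup>2 * Im (p * cnj q)
      - h * \<beta> * ((cmod u)\<^sup>2 + x * (2 * Re (p * cnj u)))
      - h * \<beta> * ((cmod u)\<^sup>2 + y * (2 * Re (q * cnj u)))
      + (cmod (of_real h * (p + \<i> * q) + of_real \<beta> * (of_real x + \<i> * of_real y) * u))\<^sup>2"
  unfolding cmod_power2 by (simp add: power2_eq_square algebra_simps)

text \<open>The difference of the two sides is at least \<open>|\<nabla>v - v \<nabla>w / w|\<^sup>2\<close>, where \<open>q = 1 / w\<close>.\<close>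

lemma barta_pointwise:
  fixes v1 v2 v :: complex and q x y m :: real
  assumes "m \<le> q"
  shows "(cmod v1)\<^sup>2 + (cmod v2)\<^sup>2 \<ge>
     (- 2 * (q + x * (2 * x * q\<^sup>2)) * (cmod v)\<^sup>2 - 2 * x * q * (2 * Re (v1 * cnj v)))
   + (- 2 * (q + y * (2 * y * q\<^sup>2)) * (cmod v)\<^sup>2 - 2 * y * q * (2 * Re (v2 * cnj v)))
   + 4 * m * (cmod v)\<^sup>2"
proof -
  have "(cmod v1)\<^sup>2 + (cmod v2)\<^sup>2 =
     (- 2 * (q + x * (2 * x * q\<^sup>2)) * (cmod v)\<^sup>2 - 2 * x * q * (2 * Re (v1 * cnj v)))
   + (- 2 * (q + y * (2 * y * q\<^sup>2)) * (cmod v)\<^sup>2 - 2 * y * q * (2 * Re (v2 * cnj v)))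
   + 4 * q * (cmod v)\<^sup>2 + (cmod (v1 + of_real (2 * x * q) * v))\<^sup>2 + (cmod (v2 + of_real (2 * y * q) * v))\<^sup>2"
    unfolding cmod_power2 by (simp add: power2_eq_square algebra_simps)
  moreover have "4 * m * (cmod v)\<^sup>2 \<le> 4 * q * (cmod v)\<^sup>2" using assms by (intro mult_right_mono) auto
  ultimately show ?thesis by (smt (verit) zero_le_power2)
qed

text \<open>With \<open>a\<close> and \<open>b\<close> the partial derivatives of a function, the
  last term is a Jacobian, so it disappears on integration and the Dirichlet energy remains.\<close>

lemma cmod_add_i_sq: "(cmod (a + \<i> * b))\<^sup>2 = (cmod a)\<^sup>2 + (cmod b)\<^sup>2 + 2 * Im (a * cnj b)"
  unfolding cmod_power2 by (simp add: power2_eq_square algebra_simps)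

text \<open>The field is \<open>N \<nabla>w / w\<close> for \<open>w = b - |x|\<^sup>2\<close>.\<close>

lemma has_grad_barta_field:
  assumes N: "has_grad N n1 n2 x" and x: "sqn x < b"
  defines "q \<equiv> \<lambda>x. inverse (b - sqn x)"
  shows "has_grad (\<lambda>x. - 2 * fst x * q x * N x)
      (- 2 * (q x + fst x * (2 * fst x * (q x)\<^sup>2)) * N x - 2 * fst x * q x * n1)
      (- 4 * fst x * snd x * (q x)\<^sup>2 * N x - 2 * fst x * q x * n2) x"
    and "has_grad (\<lambda>x. - 2 * snd x * q x * N x)
      (- 4 * fst x * snd x * (q x)\<^sup>2 * N x - 2 * snd x * q x * n1)
      (- 2 * (q x + snd x * (2 * snd x * (q x)\<^sup>2)) * N x - 2 * snd x * q x * n2) x"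
proof -
  have "((\<lambda>s. inverse (b - s)) has_field_derivative (q x)\<^sup>2) (at (sqn x))"
    using x by (auto intro!: derivative_eq_intros simp: q_def power2_eq_square)
  from has_grad_chain[OF this has_grad_sqn]
  have q: "has_grad q ((q x)\<^sup>2 * (2 * fst x)) ((q x)\<^sup>2 * (2 * snd x)) x"
    by (simp add: q_def)
  show "has_grad (\<lambda>x. - 2 * fst x * q x * N x)
      (- 2 * (q x + fst x * (2 * fst x * (q x)\<^sup>2)) * N x - 2 * fst x * q x * n1)
      (- 4 * fst x * snd x * (q x)\<^sup>2 * N x - 2 * fst x * q x * n2) x"
    by (rule has_grad_eq_rhs[OF has_grad_mult[OF has_grad_mult[OF has_grad_mult[OF has_grad_const has_grad_fst] q] N]])
      (auto simp: algebra_simps power2_eq_square)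
  show "has_grad (\<lambda>x. - 2 * snd x * q x * N x)
      (- 4 * fst x * snd x * (q x)\<^sup>2 * N x - 2 * snd x * q x * n1)
      (- 2 * (q x + snd x * (2 * snd x * (q x)\<^sup>2)) * N x - 2 * snd x * q x * n2) x"
    by (rule has_grad_eq_rhs[OF has_grad_mult[OF has_grad_mult[OF has_grad_mult[OF has_grad_const has_grad_snd] q] N]])
      (auto simp: algebra_simps power2_eq_square)
qed

text \<open>Barta's argument with \<open>w = b - |x|\<^sup>2\<close>: \<open>D\<close> is the
  divergence of \<open>|v|\<^sup>2 \<nabla>w / w\<close>, and \<open>- \<Delta>w / w = 4 / w\<close>
  exceeds \<open>4 / (b - a)\<close> on the ring. The inequality is kept pointwise, modulo a
  function of zero integral, so that it can be combined with other divergences before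
  integrating.\<close>

lemma gradient_lower_bound_ring:
  fixes v :: "pt \<Rightarrow> complex"
  assumes v: "\<And>x. has_grad v (v1 x) (v2 x) x"
    and cont: "continuous_on UNIV v1" "continuous_on UNIV v2"
    and K: "compact K" "K \<subseteq> {x. a < sqn x \<and> sqn x < b}" "\<And>x. x \<notin> K \<Longrightarrow> v x = 0"
  obtains D where "integrable lborel D" "(LINT x|lborel. D x) = 0"
    "\<And>x. (cmod (v1 x))\<^sup>2 + (cmod (v2 x))\<^sup>2 \<ge> D x + 4 / (b - a) * (cmod (v x))\<^sup>2"
proof -
  \<comment> \<open>On this disc \<open>w\<close> is positive, so the field is differentiable
    there.\<close>
  define U where "U = {x. sqn x < b}"
  have U: "open U" "K \<subseteq> U" unfolding U_def using K(2)
    by (auto intro!: open_Collect_less continuous_sqn continuous_intros)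
  define q where "q x = inverse (b - sqn x)" for x
  define N n1 n2 where "N x = (cmod (v x))\<^sup>2" and "n1 x = 2 * Re (v1 x * cnj (v x))"
    and "n2 x = 2 * Re (v2 x * cnj (v x))" for x
  have N: "has_grad N (n1 x) (n2 x) x" for x
    using has_grad_cmod_sq[OF v] unfolding N_def[abs_def] n1_def n2_def .
  have z: "v x = 0 \<and> v1 x = 0 \<and> v2 x = 0" if "x \<notin> K" for x
    using K(3)[OF that] grad_zero_off[OF compact_imp_closed[OF K(1)] K(3) that v] by simp
  then have zN: "N x = 0" "n1 x = 0" "n2 x = 0" if "x \<notin> K" for x
    using that by (auto simp: N_def n1_def n2_def)
  have cq: "continuous_on U q" unfolding q_def U_def
    by (intro continuous_intros continuous_sqn) auto
  have cN: "continuous_on U N" "continuous_on U n1" "continuous_on U n2"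
    unfolding N_def n1_def n2_def
    by (intro continuous_intros has_grad_continuous[OF v] continuous_on_subset[OF cont(1)] continuous_on_subset[OF cont(2)]; simp)+
  note g = has_grad_barta_field[where b = b and N = N and x = x and ?n1.0 = "n1 x" and ?n2.0 = "n2 x" for x, OF N, folded q_def]
  let ?H1 = "\<lambda>x. - 2 * (q x + fst x * (2 * fst x * (q x)\<^sup>2)) * N x - 2 * fst x * q x * n1 x"
  let ?H2 = "\<lambda>x. - 2 * (q x + snd x * (2 * snd x * (q x)\<^sup>2)) * N x - 2 * snd x * q x * n2 x"
  have "integrable lborel ?H1 \<and> (LINT x|lborel. ?H1 x) = 0"
    by (intro conjI integral_grad_compact_support_local(1,3)[OF U(1) K(1) U(2) g(1)])
      (auto simp: U_def zN intro!: continuous_intros cN[unfolded U_def] cq[unfolded U_def])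
  moreover have "integrable lborel ?H2 \<and> (LINT x|lborel. ?H2 x) = 0"
    by (intro conjI integral_grad_compact_support_local(2,4)[OF U(1) K(1) U(2) g(2)])
      (auto simp: U_def zN intro!: continuous_intros cN[unfolded U_def] cq[unfolded U_def])
  moreover have "(cmod (v1 x))\<^sup>2 + (cmod (v2 x))\<^sup>2 \<ge> (?H1 x + ?H2 x) + 4 / (b - a) * (cmod (v x))\<^sup>2" for x
  proof (cases "x \<in> K")
    case True
    then have "1 / (b - a) \<le> q x" using K(2)
      by (auto simp: q_def inverse_eq_divide intro!: divide_left_mono mult_pos_pos)
    from barta_pointwise[OF this, of "fst x" "v x" "v1 x" "snd x" "v2 x"] show ?thesis
      by (simp add: N_def n1_def n2_def)
  qed (simp add: z zN)
  ultimately show ?thesis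
    using that[of "\<lambda>x. ?H1 x + ?H2 x"] by simp
qed

section \<open>The lower bound for test functions\<close>

text \<open>The density \<open>T\<close> of the magnetic form is bounded below pointwise by
  \<open>W + (h * B + \<kappa>) |\<phi>|\<^sup>2\<close>, where \<open>W\<close> has zero integral.
  The summand \<open>h * B\<close> is what the Pauli form later subtracts.\<close>

lemma pauli_form_test_fun_ge:
  fixes \<rho> R B h :: real
  assumes "0 < \<rho>" "\<rho> < R" "0 < B" "0 < h" and \<phi>: "test_fun (annulus \<rho> R) \<phi>"
  defines "\<kappa> \<equiv> h\<^sup>2 * (4 / (R\<^sup>2 - \<rho>\<^sup>2)) * exp (- ((R\<^sup>2 - \<rho>\<^sup>2) * B / (2 * h)))"
  defines "T \<equiv> \<lambda>x. (cmod (of_real h * (- \<i>) * pd1 \<phi> x - of_real (B / 2 * (- snd x)) * \<phi> x))\<^sup>2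
                       + (cmod (of_real h * (- \<i>) * pd2 \<phi> x - of_real (B / 2 * fst x) * \<phi> x))\<^sup>2"
  shows "(LINT x|lborel. T x) \<ge> (h * B + \<kappa>) * (LINT x|lborel. (cmod (\<phi> x))\<^sup>2)"
proof -
  \<comment> \<open>With this constant \<open>\<psi> / h = (c / 2) |x|\<^sup>2\<close>, so
    \<open>E\<close> below is \<open>exp (\<psi> / h)\<close>.\<close>
  define c where "c = B / (2 * h)"
  have hc: "h * c = B / 2" "c > 0" using assms by (auto simp: c_def)
  have s\<phi>: "smooth2 \<phi>" using \<phi> by (simp add: test_fun_def)
  note g\<phi> = test_fun_has_grad[OF s\<phi>]
  obtain K where K: "compact K" "K \<subseteq> annulus \<rho> R" "\<And>x. x \<notin> K \<Longrightarrow> \<phi> x = 0"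
    using test_fun_support[OF \<phi>] by metis
  have K': "K \<subseteq> {x. \<rho>\<^sup>2 < sqn x \<and> sqn x < R\<^sup>2}" using K(2) by (simp add: annulus_sqn)
  have z: "pd1 \<phi> x = 0" "pd2 \<phi> x = 0" if "x \<notin> K" for x
    using grad_zero_off[OF compact_imp_closed[OF K(1)] K(3) that g\<phi>(1)] by auto

  define E where "E x = exp (c / 2 * sqn x)" for x
  define v where "v = (\<lambda>x. of_real (E x) * \<phi> x)"
  define v1 v2 where "v1 x = of_real (E x) * (pd1 \<phi> x + of_real (c * fst x) * \<phi> x)"
    and "v2 x = of_real (E x) * (pd2 \<phi> x + of_real (c * snd x) * \<phi> x)" for x
  have E: "has_grad E (E x * (c * fst x)) (E x * (c * snd x)) x" for x
  proof -
    have "((\<lambda>s. exp (c / 2 * s)) has_field_derivative E x * (c / 2)) (at (sqn x))"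
      by (auto intro!: derivative_eq_intros simp: E_def)
    from has_grad_chain[OF this has_grad_sqn] show ?thesis
      by (simp add: E_def[abs_def] mult.assoc)
  qed
  have v: "has_grad v (v1 x) (v2 x) x" for x
    unfolding v_def
    by (rule has_grad_eq_rhs[OF has_grad_mult[OF has_grad_of_real[OF E] g\<phi>(1)]])
      (auto simp: v1_def v2_def algebra_simps)
  have CE: "Ck n (\<lambda>x. of_real (E x))" for n
  proof -
    have "Ck n (\<lambda>x. complex_of_real ((\<lambda>k t. (c / 2) ^ k * exp (c / 2 * t)) 0 (1 * sqn x + 0)))"
      by (rule Ck_compose_sqn) (auto intro!: derivative_eq_intros)
    then show ?thesis by (simp add: E_def)
  qed
  have C\<phi>: "Ck n \<phi>" for n using s\<phi> by (simp add: smooth2_def)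
  have Cv: "Ck n v1" "Ck n v2" for n
    unfolding v1_def v2_def of_real_mult
    by (intro Ck_mult Ck_add CE g\<phi> Ck_const Ck_fst Ck_snd C\<phi>)+
  have zv: "v x = 0" if "x \<notin> K" for x using K(3)[OF that] by (simp add: v_def)

  obtain D where D: "integrable lborel D" "(LINT x|lborel. D x) = 0"
    "\<And>x. (cmod (v1 x))\<^sup>2 + (cmod (v2 x))\<^sup>2 \<ge> D x + 4 / (R\<^sup>2 - \<rho>\<^sup>2) * (cmod (v x))\<^sup>2"
    using gradient_lower_bound_ring[OF v Ck_imp_continuous[OF Cv(1)] Ck_imp_continuous[OF Cv(2)] K(1) K' zv] by metis
  note J\<phi> = integral_jacobian_zero[OF g\<phi> K(1,3)]
  note Jv = integral_jacobian_zero[OF v Cv K(1) zv]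

  define N where "N x = (cmod (\<phi> x))\<^sup>2" for x
  define n1 n2 where "n1 x = 2 * Re (pd1 \<phi> x * cnj (\<phi> x))" and "n2 x = 2 * Re (pd2 \<phi> x * cnj (\<phi> x))" for x
  have N: "has_grad N (n1 x) (n2 x) x" for x
    using has_grad_cmod_sq[OF g\<phi>(1)] unfolding N_def[abs_def] n1_def n2_def .
  have c\<phi>: "continuous_on UNIV \<phi>" "continuous_on UNIV (pd1 \<phi>)" "continuous_on UNIV (pd2 \<phi>)"
    by (rule Ck_imp_continuous, rule C\<phi> g\<phi>)+
  have cN: "continuous_on UNIV N" "continuous_on UNIV n1" "continuous_on UNIV n2"
    unfolding N_def n1_def n2_def by (intro continuous_intros c\<phi>)+
  have iN: "integrable lborel N"
    by (rule integrable_continuous_compact_support[OF cN(1) K(1)]) (simp add: N_def K(3))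
  have cG: "continuous_on UNIV (\<lambda>x. N x + fst x * n1 x)" "continuous_on UNIV (\<lambda>x. fst x * n2 x)"
    "continuous_on UNIV (\<lambda>x. snd x * n1 x)" "continuous_on UNIV (\<lambda>x. N x + snd x * n2 x)"
    by (intro continuous_intros cN)+
  have zN: "fst x * N x = 0" "snd x * N x = 0" if "x \<notin> K" for x
    using K(3)[OF that] by (simp_all add: N_def)
  have "has_grad (\<lambda>x. fst x * N x) (N x + fst x * n1 x) (fst x * n2 x) x" for x
    by (rule has_grad_eq_rhs[OF has_grad_mult[OF has_grad_fst N]]) auto
  note G1 = integral_grad_compact_support(1,3)[OF this cG(1,2) K(1) zN(1)]
  have "has_grad (\<lambda>x. snd x * N x) (snd x * n1 x) (N x + snd x * n2 x) x" for x
    by (rule has_grad_eq_rhs[OF has_grad_mult[OF has_grad_snd N]]) auto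
  note G2 = integral_grad_compact_support(2,4)[OF this cG(3,4) K(1) zN(2)]

  \<comment> \<open>A lower bound for \<open>h\<^sup>2 exp (- 2 \<psi> / h)\<close> on the annulus,
    approached at radius \<open>R\<close>.\<close>
  define m where "m = h\<^sup>2 * exp (- (c * R\<^sup>2))"
  \<comment> \<open>All terms of zero integral: Barta's divergence and the Jacobian for
    \<open>v\<close>, both carrying the constant weight \<open>m\<close>, then the Jacobian for
    \<open>\<phi>\<close> and the divergence from the commutator. A nonconstant weight on the first
    two could spoil their zero integrals.\<close>
  define W where "W x = m * D x + (m * 2) * Im (v1 x * cnj (v2 x)) - (2 * h\<^sup>2) * Im (pd1 \<phi> x * cnj (pd2 \<phi> x))
      - (h * (B / 2)) * (N x + fst x * n1 x) - (h * (B / 2)) * (N x + snd x * n2 x)" for x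
  have W: "integrable lborel W" "(LINT x|lborel. W x) = 0"
  proof -
    note i = integrable_mult_right[OF J\<phi>(1)] integrable_mult_right[OF Jv(1)]
      integrable_mult_right[OF G1(1)] integrable_mult_right[OF G2(1)] integrable_mult_right[OF D(1)]
    show "integrable lborel W" unfolding W_def
      by (intro Bochner_Integration.integrable_add Bochner_Integration.integrable_diff i)
    show "(LINT x|lborel. W x) = 0" unfolding W_def
      using i J\<phi>(2) Jv(2) G1(2) G2(2) D(2)
      by (simp del: minus_complex.sel times_complex.sel plus_complex.sel complex_cnj)
  qed
  \<comment> \<open>The exponential in \<open>\<kappa>\<close> splits in two:
    \<open>exp (- c R\<^sup>2)\<close> sits in \<open>m\<close>, and
    \<open>exp (c \<rho>\<^sup>2)\<close> comes from
    \<open>|v|\<^sup>2 = exp (c |x|\<^sup>2) |\<phi>|\<^sup>2\<close>.\<close>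
  have \<kappa>: "\<kappa> = m * (4 / (R\<^sup>2 - \<rho>\<^sup>2)) * exp (c * \<rho>\<^sup>2)"
  proof -
    have e: "- ((R\<^sup>2 - \<rho>\<^sup>2) * B / (2 * h)) = - (c * R\<^sup>2) + c * \<rho>\<^sup>2"
      using assms(4) by (simp add: c_def field_simps)
    show ?thesis unfolding \<kappa>_def m_def e exp_add by (simp only: mult_ac)
  qed

  have pointwise: "W x + (h * B + \<kappa>) * N x \<le> T x" for x
  proof (cases "x \<in> K")
    case False
    \<comment> \<open>Off the support \<open>D\<close> is known only through its inequality, which
      there reads \<open>D x \<le> 0\<close>; this is the direction required.\<close>
    then have "D x \<le> 0" "W x = m * D x" "T x = 0" "N x = 0"
      using D(3)[of x] K(3) z zv by (auto simp: W_def T_def N_def n1_def n2_def v1_def v2_def)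
    then show ?thesis by (simp add: m_def mult_nonneg_nonpos)
  next
    case True
    then have x: "\<rho>\<^sup>2 < sqn x" "sqn x < R\<^sup>2" using K' by auto
    let ?w = "pd1 \<phi> x + \<i> * pd2 \<phi> x + of_real c * (of_real (fst x) + \<i> * of_real (snd x)) * \<phi> x"
    have E2: "(E x)\<^sup>2 = exp (c * sqn x)"
      by (simp add: E_def power2_eq_square flip: exp_add)
    have "of_real h * (pd1 \<phi> x + \<i> * pd2 \<phi> x) + of_real (B / 2) * (of_real (fst x) + \<i> * of_real (snd x)) * \<phi> x = of_real h * ?w"
      unfolding hc(1)[symmetric] by (simp add: algebra_simps)
    then have T: "T x = h * B * N x - 2 * h\<^sup>2 * Im (pd1 \<phi> x * cnj (pd2 \<phi> x))
        - h * (B / 2) * (N x + fst x * n1 x) - h * (B / 2) * (N x + snd x * n2 x) + h\<^sup>2 * (cmod ?w)\<^sup>2"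
      using assms(4) unfolding T_def N_def n1_def n2_def magnetic_square_identity
      by (simp only: norm_mult power_mult_distrib) simp
    have "v1 x + \<i> * v2 x = of_real (E x) * ?w"
      by (simp add: v1_def v2_def algebra_simps)
    then have "(E x)\<^sup>2 * (cmod ?w)\<^sup>2 = (cmod (v1 x + \<i> * v2 x))\<^sup>2"
      by (simp add: norm_mult power_mult_distrib)
    then have Ew: "exp (c * sqn x) * (cmod ?w)\<^sup>2 = (cmod (v1 x))\<^sup>2 + (cmod (v2 x))\<^sup>2 + 2 * Im (v1 x * cnj (v2 x))"
      unfolding E2 cmod_add_i_sq .
    have "(cmod (v x))\<^sup>2 = exp (c * sqn x) * N x"
      by (simp add: v_def N_def norm_mult power_mult_distrib E2)
    also have "\<dots> \<ge> exp (c * \<rho>\<^sup>2) * N x"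
      using x hc by (intro mult_right_mono) (auto simp: N_def)
    finally have v_ge: "exp (c * \<rho>\<^sup>2) * N x \<le> (cmod (v x))\<^sup>2" .
    have "4 / (R\<^sup>2 - \<rho>\<^sup>2) > 0" using x by (intro divide_pos_pos) linarith+
    then have "4 / (R\<^sup>2 - \<rho>\<^sup>2) * (exp (c * \<rho>\<^sup>2) * N x) \<le> 4 / (R\<^sup>2 - \<rho>\<^sup>2) * (cmod (v x))\<^sup>2"
      using v_ge by (intro mult_left_mono) auto
    then have "D x + 4 / (R\<^sup>2 - \<rho>\<^sup>2) * (exp (c * \<rho>\<^sup>2) * N x) + 2 * Im (v1 x * cnj (v2 x))
        \<le> exp (c * sqn x) * (cmod ?w)\<^sup>2"
      unfolding Ew using D(3)[of x] by linarith
    \<comment> \<open>The weight is replaced by its bound while it multiplies a square. The separate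
      terms on the left have no sign, so the replacement would fail for them one by one.\<close>
    also have "\<dots> \<le> exp (c * R\<^sup>2) * (cmod ?w)\<^sup>2"
      using x hc by (intro mult_right_mono) auto
    finally have "m * (D x + 4 / (R\<^sup>2 - \<rho>\<^sup>2) * (exp (c * \<rho>\<^sup>2) * N x) + 2 * Im (v1 x * cnj (v2 x)))
        \<le> m * (exp (c * R\<^sup>2) * (cmod ?w)\<^sup>2)"
      by (intro mult_left_mono) (auto simp: m_def)
    also have "\<dots> = h\<^sup>2 * (cmod ?w)\<^sup>2" by (simp add: m_def exp_minus)
    finally show ?thesis unfolding T W_def \<kappa> by (simp only: algebra_simps)
  qed
  have "(h * B + \<kappa>) * (LINT x|lborel. N x) = (LINT x|lborel. W x + (h * B + \<kappa>) * N x)"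
    using W iN by simp
  also have "\<dots> \<le> (LINT x|lborel. T x)"
  proof (rule integral_mono[OF _ _ pointwise])
    show "integrable lborel T"
      unfolding T_def by (rule integrable_continuous_compact_support[OF _ K(1)])
        (auto intro!: continuous_intros c\<phi> simp: z K(3))
  qed (use W iN in simp)
  finally show ?thesis by (simp add: N_def[abs_def])
qed

section \<open>Passage from test functions to the closure\<close>

text \<open>One component of \<open>hD - A\<close>, cut off to \<open>\<Omega>\<close>, is a bounded
  linear map of the pair \<open>(g, u)\<close> in the squared norms because \<open>a\<close> is
  bounded on \<open>\<Omega>\<close>.\<close>

lemma magnetic_L2:
  fixes \<Omega> :: "pt set" and h :: real
  assumes \<Omega>: "\<Omega> \<in> sets borel" and a: "a \<in> borel_measurable borel" "\<And>x. x \<in> \<Omega> \<Longrightarrow> \<bar>a x\<bar> \<le> m"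
    and g: "L2fun g" and u: "L2fun u"
  defines "f \<equiv> \<lambda>x. indicat_real \<Omega> x *\<^sub>R (of_real h * (- \<i>) * g x - of_real (a x) * u x)"
  shows "f \<in> borel_measurable lborel" "integrable lborel (\<lambda>x. (cmod (f x))\<^sup>2)"
    "(LINT x|lborel. (cmod (f x))\<^sup>2) \<le> 2 * h\<^sup>2 * (LINT x|lborel. (cmod (g x))\<^sup>2) + 2 * m\<^sup>2 * (LINT x|lborel. (cmod (u x))\<^sup>2)"
proof -
  have [measurable]: "g \<in> borel_measurable borel" "u \<in> borel_measurable borel" "\<Omega> \<in> sets borel" "a \<in> borel_measurable borel"
    using \<Omega> a g u by (auto simp: L2fun_def)
  show meas: "f \<in> borel_measurable lborel" unfolding f_def by measurable
  let ?B = "\<lambda>x. 2 * h\<^sup>2 * (cmod (g x))\<^sup>2 + 2 * m\<^sup>2 * (cmod (u x))\<^sup>2"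
  have B: "integrable lborel ?B" using g u by (simp add: L2fun_def)
  have le: "(cmod (f x))\<^sup>2 \<le> ?B x" for x
  proof (cases "x \<in> \<Omega>")
    case True
    have "cmod (f x) \<le> \<bar>h\<bar> * cmod (g x) + \<bar>a x\<bar> * cmod (u x)"
      using True norm_triangle_ineq4[of "of_real h * (- \<i>) * g x" "of_real (a x) * u x"]
      by (simp add: f_def norm_mult)
    also have "\<dots> \<le> \<bar>h\<bar> * cmod (g x) + m * cmod (u x)"
      using a(2)[OF True] by (intro add_mono mult_right_mono) auto
    finally have "(cmod (f x))\<^sup>2 \<le> (\<bar>h\<bar> * cmod (g x) + m * cmod (u x))\<^sup>2"
      by (intro power_mono) auto
    also have "\<dots> \<le> ?B x"
      using zero_le_power2[of "\<bar>h\<bar> * cmod (g x) - m * cmod (u x)"]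
      by (simp add: power2_sum power2_diff power_mult_distrib)
    finally show ?thesis .
  qed (simp add: f_def)
  then show int: "integrable lborel (\<lambda>x. (cmod (f x))\<^sup>2)"
    using meas by (intro Bochner_Integration.integrable_bound[OF B] AE_I2) (auto simp: abs_le_iff)
  have "(LINT x|lborel. (cmod (f x))\<^sup>2) \<le> (LINT x|lborel. ?B x)"
    by (intro integral_mono int B le)
  then show "(LINT x|lborel. (cmod (f x))\<^sup>2) \<le> 2 * h\<^sup>2 * (LINT x|lborel. (cmod (g x))\<^sup>2) + 2 * m\<^sup>2 * (LINT x|lborel. (cmod (u x))\<^sup>2)"
    using g u by (simp add: L2fun_def)
qed

lemma L2fun_diff: "L2fun f \<Longrightarrow> L2fun g \<Longrightarrow> L2fun (\<lambda>x. f x - g x)"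
  unfolding L2fun_def using integrable_cmod_diff_sq[of f lborel g] by auto

text \<open>By linearity the error of one component is that component applied to the errors of
  \<open>\<gamma> n\<close> and \<open>\<phi> n\<close>, so it tends to zero in squared norm, and
  the squared norms converge.\<close>

lemma magnetic_integral_tendsto:
  fixes \<Omega> :: "pt set" and h :: real
  assumes \<Omega>: "\<Omega> \<in> sets borel" and a: "a \<in> borel_measurable borel" "\<And>x. x \<in> \<Omega> \<Longrightarrow> \<bar>a x\<bar> \<le> m"
    and L2: "L2fun g" "L2fun u" "\<And>n. L2fun (\<gamma> n)" "\<And>n. L2fun (\<phi> n)"
    and lim: "(\<lambda>n. L2dist2 (\<gamma> n) g) \<longlonglongrightarrow> 0" "(\<lambda>n. L2dist2 (\<phi> n) u) \<longlonglongrightarrow> 0"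
  shows "(\<lambda>n. LINT x:\<Omega>|lborel. (cmod (of_real h * (- \<i>) * \<gamma> n x - of_real (a x) * \<phi> n x))\<^sup>2)
    \<longlonglongrightarrow> (LINT x:\<Omega>|lborel. (cmod (of_real h * (- \<i>) * g x - of_real (a x) * u x))\<^sup>2)"
proof -
  define F where "F g u x = indicat_real \<Omega> x *\<^sub>R (of_real h * (- \<i>) * g x - of_real (a x) * u x)"
    for g u :: "pt \<Rightarrow> complex" and x
  have F: "F g u \<in> borel_measurable lborel" "integrable lborel (\<lambda>x. (cmod (F g u x))\<^sup>2)"
    "(LINT x|lborel. (cmod (F g u x))\<^sup>2)
      \<le> 2 * h\<^sup>2 * (LINT x|lborel. (cmod (g x))\<^sup>2) + 2 * m\<^sup>2 * (LINT x|lborel. (cmod (u x))\<^sup>2)"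
    if "L2fun g" "L2fun u" for g u
    unfolding F_def[abs_def] by (rule magnetic_L2[OF \<Omega> a(1) _ that]; erule a(2))+
  have F_diff: "F g u x - F g' u' x = F (\<lambda>x. g x - g' x) (\<lambda>x. u x - u' x) x" for g u g' u' x
    by (simp add: F_def algebra_simps)
  have "(\<lambda>n. 2 * h\<^sup>2 * L2dist2 (\<gamma> n) g + 2 * m\<^sup>2 * L2dist2 (\<phi> n) u) \<longlonglongrightarrow> 2 * h\<^sup>2 * 0 + 2 * m\<^sup>2 * 0"
    by (intro tendsto_intros lim)
  then have *: "(\<lambda>n. 2 * h\<^sup>2 * L2dist2 (\<gamma> n) g + 2 * m\<^sup>2 * L2dist2 (\<phi> n) u) \<longlonglongrightarrow> 0" by simp
  have "norm (LINT x|lborel. (cmod (F (\<gamma> n) (\<phi> n) x - F g u x))\<^sup>2)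
      \<le> 2 * h\<^sup>2 * L2dist2 (\<gamma> n) g + 2 * m\<^sup>2 * L2dist2 (\<phi> n) u" for n
    using F(3)[OF L2fun_diff[OF L2(3)[of n] L2(1)] L2fun_diff[OF L2(4)[of n] L2(2)]]
    unfolding F_diff L2dist2_def by simp
  then have "(\<lambda>n. LINT x|lborel. (cmod (F (\<gamma> n) (\<phi> n) x - F g u x))\<^sup>2) \<longlonglongrightarrow> 0"
    by (intro Lim_null_comparison[OF always_eventually *]) simp
  from integral_cmod_sq_tendsto[OF F(1)[OF L2(3,4)] F(2)[OF L2(3,4)] F(1)[OF L2(1,2)] F(2)[OF L2(1,2)] this]
  have "(\<lambda>n. LINT x|lborel. (cmod (F (\<gamma> n) (\<phi> n) x))\<^sup>2) \<longlonglongrightarrow> (LINT x|lborel. (cmod (F g u x))\<^sup>2)" .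
  moreover have "(LINT x|lborel. (cmod (F g u x))\<^sup>2) =
     (LINT x:\<Omega>|lborel. (cmod (of_real h * (- \<i>) * g x - of_real (a x) * u x))\<^sup>2)" for g u
    unfolding set_lebesgue_integral_def
    by (intro Bochner_Integration.integral_cong) (auto simp: F_def indicator_def)
  ultimately show ?thesis by simp
qed

lemma magnetic_set_integrable:
  fixes \<Omega> :: "pt set" and h :: real
  assumes "\<Omega> \<in> sets borel" "a \<in> borel_measurable borel" "\<And>x. x \<in> \<Omega> \<Longrightarrow> \<bar>a x\<bar> \<le> m" "L2fun g" "L2fun u"
  shows "set_integrable lborel \<Omega> (\<lambda>x. (cmod (of_real h * (- \<i>) * g x - of_real (a x) * u x))\<^sup>2)"
  unfolding set_integrable_def
  by (rule Bochner_Integration.integrable_cong[THEN iffD1, OF refl _ magnetic_L2(2)[OF assms, of h]])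
    (auto simp: indicator_def)

lemma annulus_coordinate_bounds:
  assumes "x \<in> annulus \<rho> R" "0 < R" shows "\<bar>fst x\<bar> \<le> R" "\<bar>snd x\<bar> \<le> R"
proof -
  have "(fst x)\<^sup>2 + (snd x)\<^sup>2 < R\<^sup>2" using assms by (simp add: annulus_def)
  then have "(fst x)\<^sup>2 \<le> R\<^sup>2" "(snd x)\<^sup>2 \<le> R\<^sup>2"
    using zero_le_power2[of "fst x"] zero_le_power2[of "snd x"] by linarith+
  then show "\<bar>fst x\<bar> \<le> R" "\<bar>snd x\<bar> \<le> R" 
    using assms(2) abs_le_square_iff[of "fst x" R] abs_le_square_iff[of "snd x" R] by auto
qed

text \<open>Both sides of the inequality for test functions are continuous under the convergence
  that defines \<open>H10\<close>, so it survives the limit.\<close>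

lemma pauli_form_ge:
  fixes \<rho> R B h :: real
  assumes pos: "0 < \<rho>" "\<rho> < R" "0 < B" "0 < h" and H: "H10 (annulus \<rho> R) u g1 g2"
  defines "\<kappa> \<equiv> h\<^sup>2 * (4 / (R\<^sup>2 - \<rho>\<^sup>2)) * exp (- ((R\<^sup>2 - \<rho>\<^sup>2) * B / (2 * h)))"
  shows "(LINT x:annulus \<rho> R|lborel. (cmod (of_real h * (- \<i>) * g1 x - of_real (B / 2 * (- snd x)) * u x))\<^sup>2
           + (cmod (of_real h * (- \<i>) * g2 x - of_real (B / 2 * fst x) * u x))\<^sup>2)
     \<ge> (h * B + \<kappa>) * (LINT x:annulus \<rho> R|lborel. (cmod (u x))\<^sup>2)"
proof -
  let ?\<Omega> = "annulus \<rho> R"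
  obtain \<phi> where L2: "L2fun u" "L2fun g1" "L2fun g2" and \<phi>: "\<And>n. test_fun ?\<Omega> (\<phi> n)"
    and lim: "(\<lambda>n. L2dist2 (\<phi> n) u) \<longlonglongrightarrow> 0" "(\<lambda>n. L2dist2 (pd1 (\<phi> n)) g1) \<longlonglongrightarrow> 0"
      "(\<lambda>n. L2dist2 (pd2 (\<phi> n)) g2) \<longlonglongrightarrow> 0"
    using H unfolding H10_def by blast
  have \<Omega>: "?\<Omega> \<in> sets borel"
    unfolding annulus_sqn by (intro borel_open open_Collect_conj open_Collect_less continuous_sqn continuous_on_const)
  have a: "(\<lambda>x::pt. B / 2 * (- snd x)) \<in> borel_measurable borel" "(\<lambda>x::pt. B / 2 * fst x) \<in> borel_measurable borel"
    by (auto intro!: borel_measurable_continuous_onI continuous_intros)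
  have bd: "\<bar>B / 2 * (- snd x)\<bar> \<le> B / 2 * R" "\<bar>B / 2 * fst x\<bar> \<le> B / 2 * R" if "x \<in> ?\<Omega>" for x
    using annulus_coordinate_bounds[OF that] pos by (auto simp: abs_mult)
  define t1 t2 where "t1 g v x = (cmod (of_real h * (- \<i>) * g x - of_real (B / 2 * (- snd x)) * v x))\<^sup>2"
    and "t2 g v x = (cmod (of_real h * (- \<i>) * g x - of_real (B / 2 * fst x) * v x))\<^sup>2"
    for g v :: "pt \<Rightarrow> complex" and x :: pt
  have split: "(LINT x:?\<Omega>|lborel. t1 g v x + t2 g' v x) = (LINT x:?\<Omega>|lborel. t1 g v x) + (LINT x:?\<Omega>|lborel. t2 g' v x)"
    if "L2fun g" "L2fun g'" "L2fun v" for g g' v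
    unfolding t1_def t2_def
    by (intro set_integral_add magnetic_set_integrable[OF \<Omega> a(1) bd(1)] magnetic_set_integrable[OF \<Omega> a(2) bd(2)] that)
  have "(\<lambda>n. (LINT x:?\<Omega>|lborel. t1 (pd1 (\<phi> n)) (\<phi> n) x) + (LINT x:?\<Omega>|lborel. t2 (pd2 (\<phi> n)) (\<phi> n) x))
     \<longlonglongrightarrow> (LINT x:?\<Omega>|lborel. t1 g1 u x) + (LINT x:?\<Omega>|lborel. t2 g2 u x)"
    unfolding t1_def t2_def
    by (intro tendsto_add magnetic_integral_tendsto[OF \<Omega> a(1) bd(1)] magnetic_integral_tendsto[OF \<Omega> a(2) bd(2)]
        L2 test_fun_L2[OF \<phi>] lim)
  then have lim_form: "(\<lambda>n. LINT x:?\<Omega>|lborel. t1 (pd1 (\<phi> n)) (\<phi> n) x + t2 (pd2 (\<phi> n)) (\<phi> n) x)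
     \<longlonglongrightarrow> (LINT x:?\<Omega>|lborel. t1 g1 u x + t2 g2 u x)"
    by (simp add: split L2 test_fun_L2[OF \<phi>])
  \<comment> \<open>With \<open>h = 0\<close> and potential 1 the component is \<open>- u\<close>,
    so the same convergence lemma yields the squared norms of the functions themselves.\<close>
  have "(\<lambda>n. LINT x:?\<Omega>|lborel. (cmod (of_real 0 * (- \<i>) * \<phi> n x - of_real 1 * \<phi> n x))\<^sup>2)
     \<longlonglongrightarrow> (LINT x:?\<Omega>|lborel. (cmod (of_real 0 * (- \<i>) * u x - of_real 1 * u x))\<^sup>2)"
    by (rule magnetic_integral_tendsto[where m = 1, OF \<Omega>]) (auto intro: L2 test_fun_L2[OF \<phi>] lim)
  then have lim_norm: "(\<lambda>n. (h * B + \<kappa>) * (LINT x:?\<Omega>|lborel. (cmod (\<phi> n x))\<^sup>2))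
     \<longlonglongrightarrow> (h * B + \<kappa>) * (LINT x:?\<Omega>|lborel. (cmod (u x))\<^sup>2)"
    by (intro tendsto_mult tendsto_const) simp
  have "(h * B + \<kappa>) * (LINT x:?\<Omega>|lborel. (cmod (\<phi> n x))\<^sup>2)
     \<le> (LINT x:?\<Omega>|lborel. t1 (pd1 (\<phi> n)) (\<phi> n) x + t2 (pd2 (\<phi> n)) (\<phi> n) x)" for n
  proof -
    obtain K where K: "compact K" "K \<subseteq> ?\<Omega>" "\<And>x. x \<notin> K \<Longrightarrow> \<phi> n x = 0"
      using test_fun_support[OF \<phi>[of n]] by metis
    have s: "smooth2 (\<phi> n)" using \<phi>[of n] by (simp add: test_fun_def)
    have z: "\<phi> n x = 0" "pd1 (\<phi> n) x = 0" "pd2 (\<phi> n) x = 0" if "x \<notin> K" for x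
      using K(3)[OF that] grad_zero_off[OF compact_imp_closed[OF K(1)] K(3) that test_fun_has_grad(1)[OF s]]
      by auto
    have "(LINT x:?\<Omega>|lborel. (cmod (\<phi> n x))\<^sup>2) = (LINT x|lborel. (cmod (\<phi> n x))\<^sup>2)"
      unfolding set_lebesgue_integral_def using K
      by (intro Bochner_Integration.integral_cong) (auto simp: indicator_def)
    moreover have "(LINT x:?\<Omega>|lborel. t1 (pd1 (\<phi> n)) (\<phi> n) x + t2 (pd2 (\<phi> n)) (\<phi> n) x)
       = (LINT x|lborel. t1 (pd1 (\<phi> n)) (\<phi> n) x + t2 (pd2 (\<phi> n)) (\<phi> n) x)"
      unfolding set_lebesgue_integral_def
    proof (intro Bochner_Integration.integral_cong refl)
      fix x
      show "indicat_real ?\<Omega> x *\<^sub>R (t1 (pd1 (\<phi> n)) (\<phi> n) x + t2 (pd2 (\<phi> n)) (\<phi> n) x)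
         = t1 (pd1 (\<phi> n)) (\<phi> n) x + t2 (pd2 (\<phi> n)) (\<phi> n) x"
      proof (cases "x \<in> ?\<Omega>")
        case False
        with K(2) have "x \<notin> K" by blast
        from z[OF this] show ?thesis by (simp add: t1_def t2_def)
      qed simp
    qed
    ultimately show ?thesis
      using pauli_form_test_fun_ge[OF pos \<phi>[of n]] by (simp add: t1_def t2_def \<kappa>_def)
  qed
  then have "(h * B + \<kappa>) * (LINT x:?\<Omega>|lborel. (cmod (u x))\<^sup>2) \<le> (LINT x:?\<Omega>|lborel. t1 g1 u x + t2 g2 u x)"
    by (intro LIMSEQ_le[OF lim_norm lim_form]) auto
  then show ?thesis by (simp add: t1_def t2_def)
qed

section \<open>The bound for the infimum\<close>

theorem theorem7p1:
  fixes \<rho> R B h :: real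
  assumes "0 < \<rho>" and "\<rho> < R" and "0 < B" and "0 < h"
  shows "lambda_D_Pminus h (\<lambda>x. ((B / 2) * (- snd x), (B / 2) * fst x)) (\<lambda>x. B) (annulus \<rho> R)
           \<ge> h\<^sup>2 * (j0_first_zero\<^sup>2 / (pi * (R\<^sup>2 - \<rho>\<^sup>2))) * exp (- ((R\<^sup>2 - \<rho>\<^sup>2) * B / (2 * h)))"
  unfolding lambda_D_Pminus_def
\<comment> \<open>The infimum of an empty set of reals is unspecified, so the existence of an
  admissible function has to be shown first.\<close>
proof (rule cInf_greatest)
  let ?A = "\<lambda>x. ((B / 2) * (- snd x), (B / 2) * fst x)"
  obtain \<phi> x where "test_fun (annulus \<rho> R) \<phi>" "\<phi> x \<noteq> 0"
    using test_fun_annulus_exists[OF assms(1,2)] by metis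
  then show "{pauli_quot h ?A (\<lambda>x. B) (annulus \<rho> R) u g1 g2 | u g1 g2.
      H10 (annulus \<rho> R) u g1 g2 \<and> (LINT x:annulus \<rho> R|lborel. (cmod (u x))\<^sup>2) \<noteq> 0} \<noteq> {}"
    using test_fun_H10 integral_cmod_sq_test_fun_nonzero by blast
next
  let ?A = "\<lambda>x. ((B / 2) * (- snd x), (B / 2) * fst x)"
  fix y
  assume "y \<in> {pauli_quot h ?A (\<lambda>x. B) (annulus \<rho> R) u g1 g2 | u g1 g2.
      H10 (annulus \<rho> R) u g1 g2 \<and> (LINT x:annulus \<rho> R|lborel. (cmod (u x))\<^sup>2) \<noteq> 0}"
  then obtain u g1 g2 where y: "y = pauli_quot h ?A (\<lambda>x. B) (annulus \<rho> R) u g1 g2"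
    and H: "H10 (annulus \<rho> R) u g1 g2" and nz: "(LINT x:annulus \<rho> R|lborel. (cmod (u x))\<^sup>2) \<noteq> 0" by blast
  let ?N = "LINT x:annulus \<rho> R|lborel. (cmod (u x))\<^sup>2"
  let ?\<kappa> = "h\<^sup>2 * (4 / (R\<^sup>2 - \<rho>\<^sup>2)) * exp (- ((R\<^sup>2 - \<rho>\<^sup>2) * B / (2 * h)))"
  have "?N \<ge> 0" by (simp add: set_lebesgue_integral_def)
  with nz have N: "?N > 0" by simp
  \<comment> \<open>As \<open>B\<close> is constant, the subtracted term is exactly
    \<open>h * B\<close> times the squared norm and leaves \<open>\<kappa>\<close>.\<close>
  have quot: "((h * B + k) * n - h * (B * n)) / n = k" if "n > 0" for k n :: real
    using that by (simp add: field_simps)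
  have d: "R\<^sup>2 - \<rho>\<^sup>2 > 0" using assms by (simp add: power_strict_mono)
  \<comment> \<open>Barta's constant 4 suffices since
    \<open>j\<^sup>2 \<le> 8 < 12 < 4 \<pi>\<close>.\<close>
  have "j0_first_zero\<^sup>2 / (pi * (R\<^sup>2 - \<rho>\<^sup>2)) \<le> (4 * pi) / (pi * (R\<^sup>2 - \<rho>\<^sup>2))"
    using j0_first_zero_bound pi_gt3 d by (intro divide_right_mono) auto
  also have "\<dots> = 4 / (R\<^sup>2 - \<rho>\<^sup>2)" by simp
  finally have "h\<^sup>2 * (j0_first_zero\<^sup>2 / (pi * (R\<^sup>2 - \<rho>\<^sup>2))) * exp (- ((R\<^sup>2 - \<rho>\<^sup>2) * B / (2 * h))) \<le> ?\<kappa>"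
    by (intro mult_right_mono mult_left_mono) auto
  also have "?\<kappa> = ((h * B + ?\<kappa>) * ?N - h * (B * ?N)) / ?N"
    using N quot by simp
  also have "\<dots> \<le> y"
    unfolding y pauli_quot_def set_integral_mult_right fst_conv snd_conv
    using pauli_form_ge[OF assms H] N by (intro divide_right_mono diff_right_mono) auto
  finally show "h\<^sup>2 * (j0_first_zero\<^sup>2 / (pi * (R\<^sup>2 - \<rho>\<^sup>2))) * exp (- ((R\<^sup>2 - \<rho>\<^sup>2) * B / (2 * h))) \<le> y" .
qed

end
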